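(* Let $\bar x\in\Phi$ be a local second-order weak sharp minimizer of problem (P) with corresponding constants $\kappa>0$ and $\delta>0$. Suppose that DirRCQ holds at every $x\in\Phi\cap B_\delta(\bar x)$ in every direction $d\in C(x)$. Then for any $\varepsilon\in[0,1/2)$, $x\in S\cap B_\delta(\bar x)$ and $d\in C(x)\cap N^{P,\varepsilon}_S(x)$: (i) for every $v\in T''_K(g(x);\nabla g(x)d)$ there exists $\lambda_v\in\Lambda^c(x;d)$ with $\langle\lambda_v,v\rangle\le0$; (ii) for every $w\in T^2_K(g(x);\nabla g(x)d)$ there exists $\lambda_w\in\Lambda^c(x;d)$ with $\nabla^2_{xx}L(x,\lambda_w)(d,d)-\langle\lambda_w,w\rangle\ge2\kappa(1-2\varepsilon)^2\|d\|^2$. Moreover, for every $x\in S\cap B_\delta(\bar x)$ and every $d\in C(x)$, (i) holds and (ii) holds with the right-hand side replaced by $2\kappa[\mathrm{dist}(d,T_S(x))]^2$.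
   Context: Standing setting: $f:\mathbb{R}^n\to\mathbb{R}$, $g:\mathbb{R}^n\to\mathbb{R}^m$ twice continuously differentiable, $K\subset\mathbb{R}^m$ closed; (P) is $\min f(x)$ s.t. $g(x)\in K$; $\Phi:=\{x:g(x)\in K\}$; $S$ is the (nonempty) set of optimal solutions; $L(x,\lambda):=f(x)+\langle g(x),\lambda\rangle$. $\bar x\in\Phi$ is a local second-order weak sharp minimizer with constants $\kappa,\delta>0$ if $f(x)\ge f(\bar x)+\kappa[\mathrm{dist}(x,S)]^2$ for all $x\in\Phi\cap B_\delta(\bar x)$. For a closed set $A$ and $\bar x\in A$: $T_A(\bar x):=\{d:\exists t_k\downarrow0,d_k\to d,\bar x+t_kd_k\in A\}$; for $d\in T_A(\bar x)$, $T^2_A(\bar x;d):=\{w:\exists t_k\downarrow0,w_k\to w,\bar x+t_kd+\tfrac12t_k^2w_k\in A\}$, $T''_A(\bar x;d):=\{w:\exists(t_k,r_k)\downarrow(0,0),t_k/r_k\to0,w_k\to w,\bar x+t_kd+\tfrac12t_kr_kw_k\in A\}$. $C(x):=\{d:\nabla g(x)d\in T_K(g(x)),\nabla f(x)d\le0\}$. $N^P_A(\bar x):=\{v:\exists\tau>0,\ \bar x\text{ is a nearest point of }A\text{ to }\bar x+\tau v\}$; $N^{P,\varepsilon}_A(\bar x):=\{v:\mathrm{dist}(v,N^P_A(\bar x))\le\varepsilon\|v\|\}$. Fréchet normal cone $\hat N_A(y):=\{v:\limsup_{y'\to y,y'\in A}\langle v,y'-y\rangle/\|y'-y\|\le0\}$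 (empty if $y\notin A$); directional limiting normal cone $N_A(\bar y;u):=\{v:\exists t_k\downarrow0,u_k\to u,v_k\to v,\ v_k\in\hat N_A(\bar y+t_ku_k)\}$; directional Clarke normal cone $N^c_A(\bar y;u):=\mathrm{cl}\,\mathrm{co}\,N_A(\bar y;u)$. Directional C-multiplier set: $\Lambda^c(x;d):=\{\lambda:\nabla_xL(x,\lambda)=0,\ \lambda\in N^c_K(g(x);\nabla g(x)d)\}$. DirRCQ holds at $x$ in direction $d$ if $\nabla g(x)^T\lambda=0,\ \lambda\in N^c_K(g(x);\nabla g(x)d)$ imply $\lambda=0$. $\nabla^2g(x)(d,d):=(d^T\nabla^2g_i(x)d)_{i=1}^m$. *)

theory Defs
  imports "HOL-Analysis.Analysis" "HOL-Library.Liminf_Limsup"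
begin

text \<open>Points of R^n are elements of a Euclidean space 'a, points of R^m of a Euclidean space 'b.
  Derivatives are bounded linear maps: the first derivative of f at x is Df x, the second D2f x,
  so that nabla f(x) d = Df x d and d^T nabla^2 f(x) d = D2f x d d.\<close>

definition tangent_cone :: "'a::real_normed_vector set \<Rightarrow> 'a \<Rightarrow> 'a set" where
  "tangent_cone A x = {d. \<exists>t u. (\<forall>k. t k > 0) \<and> t \<longlonglongrightarrow> 0 \<and> u \<longlonglongrightarrow> d
      \<and> (\<forall>k. x + t k *\<^sub>R u k \<in> A)}"

definition second_tangent_set :: "'a::real_normed_vector set \<Rightarrow> 'a \<Rightarrow> 'a \<Rightarrow> 'a set" where
  "second_tangent_set A x d = {w. \<exists>t wk. (\<forall>k. t k > 0) \<and> t \<longlonglongrightarrow> 0 \<and> wk \<longlonglongrightarrow> w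
      \<and> (\<forall>k. x + t k *\<^sub>R d + ((1/2) * (t k)^2) *\<^sub>R wk k \<in> A)}"

definition asymptotic_second_tangent_cone :: "'a::real_normed_vector set \<Rightarrow> 'a \<Rightarrow> 'a \<Rightarrow> 'a set" where
  "asymptotic_second_tangent_cone A x d = {w. \<exists>t r wk. (\<forall>k. t k > 0 \<and> r k > 0)
      \<and> t \<longlonglongrightarrow> 0 \<and> r \<longlonglongrightarrow> 0 \<and> (\<lambda>k. t k / r k) \<longlonglongrightarrow> 0 \<and> wk \<longlonglongrightarrow> w
      \<and> (\<forall>k. x + t k *\<^sub>R d + ((1/2) * t k * r k) *\<^sub>R wk k \<in> A)}"

definition proximal_normal_cone :: "'a::real_normed_vector set \<Rightarrow> 'a \<Rightarrow> 'a set" where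
  "proximal_normal_cone A x = {v. \<exists>\<tau>>0. x \<in> A \<and>
      (\<forall>a\<in>A. dist (x + \<tau> *\<^sub>R v) x \<le> dist (x + \<tau> *\<^sub>R v) a)}"

definition eps_proximal_normal_cone :: "real \<Rightarrow> 'a::real_normed_vector set \<Rightarrow> 'a \<Rightarrow> 'a set" where
  "eps_proximal_normal_cone \<epsilon> A x = {v. infdist v (proximal_normal_cone A x) \<le> \<epsilon> * norm v}"

definition frechet_normal_cone :: "'a::real_inner set \<Rightarrow> 'a \<Rightarrow> 'a set" where
  "frechet_normal_cone A y = (if y \<in> A then
      {v. Limsup (at y within A) (\<lambda>y'. ereal ((v \<bullet> (y' - y)) / norm (y' - y))) \<le> 0} else {})"

definition dir_limiting_normal_cone :: "'a::real_inner set \<Rightarrow> 'a \<Rightarrow> 'a \<Rightarrow> 'a set" where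
  "dir_limiting_normal_cone A y u = {v. \<exists>t uk vk. (\<forall>k. t k > 0) \<and> t \<longlonglongrightarrow> 0
      \<and> uk \<longlonglongrightarrow> u \<and> vk \<longlonglongrightarrow> v \<and> (\<forall>k. vk k \<in> frechet_normal_cone A (y + t k *\<^sub>R uk k))}"

definition dir_clarke_normal_cone :: "'a::real_inner set \<Rightarrow> 'a \<Rightarrow> 'a \<Rightarrow> 'a set" where
  "dir_clarke_normal_cone A y u = closure (convex hull (dir_limiting_normal_cone A y u))"

definition feasible_set :: "('a \<Rightarrow> 'b) \<Rightarrow> 'b set \<Rightarrow> 'a set" where
  "feasible_set g K = {x. g x \<in> K}"

definition optimal_set :: "('a \<Rightarrow> real) \<Rightarrow> ('a \<Rightarrow> 'b) \<Rightarrow> 'b set \<Rightarrow> 'a set" where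
  "optimal_set f g K = {x \<in> feasible_set g K. \<forall>y \<in> feasible_set g K. f x \<le> f y}"

definition local_2nd_order_weak_sharp_min ::
  "('a::real_normed_vector \<Rightarrow> real) \<Rightarrow> ('a \<Rightarrow> 'b) \<Rightarrow> 'b set \<Rightarrow> 'a \<Rightarrow> real \<Rightarrow> real \<Rightarrow> bool" where
  "local_2nd_order_weak_sharp_min f g K xb \<kappa> \<delta> \<longleftrightarrow> xb \<in> feasible_set g K \<and>
     (\<forall>x \<in> feasible_set g K \<inter> ball xb \<delta>.
        f x \<ge> f xb + \<kappa> * (infdist x (optimal_set f g K))^2)"

definition critical_cone ::
  "('a::real_normed_vector \<Rightarrow> 'a \<Rightarrow>\<^sub>L real) \<Rightarrow> ('a \<Rightarrow> 'a \<Rightarrow>\<^sub>L 'b::real_normed_vector) \<Rightarrow> ('a \<Rightarrow> 'b) \<Rightarrow> 'b set \<Rightarrow> 'a \<Rightarrow> 'a set" where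
  "critical_cone Df Dg g K x = {d. Dg x d \<in> tangent_cone K (g x) \<and> Df x d \<le> 0}"

text \<open>Directional C-multiplier set: nabla_x L(x,lambda) = 0 written as the linear functional
  h \<mapsto> nabla f(x)h + <lambda, nabla g(x)h> being zero.\<close>
definition dir_C_multipliers ::
  "('a::real_normed_vector \<Rightarrow> 'a \<Rightarrow>\<^sub>L real) \<Rightarrow> ('a \<Rightarrow> 'a \<Rightarrow>\<^sub>L 'b::real_inner) \<Rightarrow> ('a \<Rightarrow> 'b) \<Rightarrow> 'b set \<Rightarrow> 'a \<Rightarrow> 'a \<Rightarrow> 'b set" where
  "dir_C_multipliers Df Dg g K x d = {l. (\<forall>h. Df x h + l \<bullet> Dg x h = 0)
      \<and> l \<in> dir_clarke_normal_cone K (g x) (Dg x d)}"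

definition DirRCQ ::
  "('a::real_normed_vector \<Rightarrow> 'a \<Rightarrow>\<^sub>L 'b::real_inner) \<Rightarrow> ('a \<Rightarrow> 'b) \<Rightarrow> 'b set \<Rightarrow> 'a \<Rightarrow> 'a \<Rightarrow> bool" where
  "DirRCQ Dg g K x d \<longleftrightarrow> (\<forall>l. (\<forall>h. l \<bullet> Dg x h = 0)
      \<and> l \<in> dir_clarke_normal_cone K (g x) (Dg x d) \<longrightarrow> l = 0)"

definition hessL_dd ::
  "('a::real_normed_vector \<Rightarrow> 'a \<Rightarrow>\<^sub>L 'a \<Rightarrow>\<^sub>L real) \<Rightarrow> ('a \<Rightarrow> 'a \<Rightarrow>\<^sub>L 'a \<Rightarrow>\<^sub>L 'b::real_inner) \<Rightarrow> 'a \<Rightarrow> 'b \<Rightarrow> 'a \<Rightarrow> real" where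
  "hessL_dd D2f D2g x l d = D2f x d d + l \<bullet> D2g x d d"

end

theory Submission
  imports Defs
begin

text \<open>
  Both second-order tangent sets are handled at once: take \<open>g x + t\<^sub>k \<nabla>g(x)d + s\<^sub>k w\<^sub>k \<in> K\<close> with
  \<open>s\<^sub>k / t\<^sub>k \<rightarrow> 0\<close> and \<open>t\<^sub>k\<^sup>2 / (2 s\<^sub>k) \<rightarrow> c\<close>, where \<open>c = 0\<close> gives (i) and \<open>c = 1\<close> gives (ii).
  If \<open>h\<close> satisfies \<open>\<langle>\<lambda>, \<nabla>g(x)h + c \<nabla>\<^sup>2g(x)(d,d) - w\<rangle> \<le> 0\<close> for all \<open>\<lambda>\<close> in the directional Clarke
  normal cone, then \<open>g(x + t\<^sub>k d + s\<^sub>k h)\<close> has distance \<open>o(s\<^sub>k)\<close> from \<open>K\<close>, and by DirRCQ these points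
  have distance \<open>o(s\<^sub>k)\<close> from the feasible set. Quadratic growth at nearby feasible points
  gives \<open>\<nabla>f(x)h + c \<nabla>\<^sup>2f(x)(d,d) \<ge> 2 c \<kappa> dist(d, T\<^sub>S(x))\<^sup>2\<close>. The multiplier is the dual solution of this
  linear conic program in \<open>h\<close>; DirRCQ closes the dual cone and makes the primal feasible.
\<close>

section \<open>Directional normal cones\<close>

text \<open>The filter \<open>at y within A\<close> omits \<open>y\<close>, so the quotient under
  the limsup has a nonzero denominator and can be multiplied out. This trades extended reals for
  eventual linear inequalities.\<close>

lemma mem_frechet_normal_cone_iff:
  "v \<in> frechet_normal_cone A y \<longleftrightarrow> y \<in> A \<and>
    (\<forall>e>0. \<forall>\<^sub>F y' in at y within A. v \<bullet> (y' - y) \<le> e * norm (y' - y))"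
proof -
  let ?q = "\<lambda>y'. (v \<bullet> (y' - y)) / norm (y' - y)"
  have "Limsup (at y within A) (\<lambda>y'. ereal (?q y')) \<le> 0 \<longleftrightarrow>
      (\<forall>e>0. \<forall>\<^sub>F y' in at y within A. v \<bullet> (y' - y) \<le> e * norm (y' - y))" (is "?L \<longleftrightarrow> ?R")
  proof
    assume L: ?L
    show ?R
    proof (intro allI impI)
      fix e :: real assume "e > 0"
      then have "\<forall>\<^sub>F y' in at y within A. ereal (?q y') < ereal e"
        using L by (metis Limsup_le_iff ereal_less(2))
      moreover have "\<forall>\<^sub>F y' in at y within A. y' \<noteq> y"
        by (auto simp: eventually_at_filter)
      ultimately show "\<forall>\<^sub>F y' in at y within A. v \<bullet> (y' - y) \<le> e * norm (y' - y)"
        by eventually_elim (auto simp: field_simps)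
    qed
  next
    assume R: ?R
    show ?L
    proof (rule ereal_le_epsilon2)
      fix e :: real assume "e > 0"
      then have "\<forall>\<^sub>F y' in at y within A. v \<bullet> (y' - y) \<le> e * norm (y' - y)"
        using R by blast
      moreover have "\<forall>\<^sub>F y' in at y within A. y' \<noteq> y"
        by (auto simp: eventually_at_filter)
      ultimately have "\<forall>\<^sub>F y' in at y within A. ereal (?q y') \<le> ereal e"
        by eventually_elim (auto simp: field_simps)
      then show "Limsup (at y within A) (\<lambda>y'. ereal (?q y')) \<le> 0 + ereal e"
        by (simp add: Limsup_bounded)
    qed
  qed
  then show ?thesis by (auto simp: frechet_normal_cone_def)
qed

lemma frechet_normal_cone_scaleR:
  assumes "v \<in> frechet_normal_cone A y" "c \<ge> 0"
  shows "c *\<^sub>R v \<in> frechet_normal_cone A y"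
  unfolding mem_frechet_normal_cone_iff
proof (intro conjI allI impI)
  show "y \<in> A" using assms(1) by (simp add: mem_frechet_normal_cone_iff)
  fix e :: real assume e: "e > 0"
  \<comment> \<open>The summand 1 covers \<open>c = 0\<close>.\<close>
  define e' where "e' = e / (c + 1)"
  have "e' > 0" "c * e' \<le> e" using e assms(2) by (auto simp: e'_def field_simps)
  have "\<forall>\<^sub>F y' in at y within A. v \<bullet> (y' - y) \<le> e' * norm (y' - y)"
    using assms(1) \<open>e' > 0\<close> by (simp add: mem_frechet_normal_cone_iff)
  then show "\<forall>\<^sub>F y' in at y within A. (c *\<^sub>R v) \<bullet> (y' - y) \<le> e * norm (y' - y)"
  proof eventually_elim
    case (elim y')
    have "c * (v \<bullet> (y' - y)) \<le> c * (e' * norm (y' - y))"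
      using elim assms(2) by (rule mult_left_mono)
    also have "\<dots> \<le> e * norm (y' - y)"
      using mult_right_mono[OF \<open>c * e' \<le> e\<close>, of "norm (y' - y)"] by (simp add: mult.assoc)
    finally show ?case by simp
  qed
qed

text \<open>Squaring the nearest-point inequality gives 2 <p - q, y - q> \<le> |y - q|^2, which is
  o(|y - q|).\<close>

lemma nearest_point_frechet_normal:
  fixes p q :: "'a::real_inner"
  assumes "q \<in> A" and near: "\<And>a. a \<in> A \<Longrightarrow> dist p q \<le> dist p a"
  shows "p - q \<in> frechet_normal_cone A q"
  unfolding mem_frechet_normal_cone_iff
proof (intro conjI allI impI)
  fix e :: real assume e: "e > 0"
  show "\<forall>\<^sub>F y in at q within A. (p - q) \<bullet> (y - q) \<le> e * norm (y - q)"
    unfolding eventually_at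
  proof (intro exI[of _ e] conjI ballI impI e)
    fix y assume "y \<in> A" and y: "y \<noteq> q \<and> dist y q < e"
    then have "(norm (p - q))\<^sup>2 \<le> (norm ((p - q) - (y - q)))\<^sup>2"
      using near[OF \<open>y \<in> A\<close>] by (simp add: dist_norm power_mono)
    then have "2 * ((p - q) \<bullet> (y - q)) \<le> norm (y - q) * norm (y - q)"
      by (simp only: power2_norm_eq_inner inner_diff_left inner_diff_right inner_commute
          flip: power2_eq_square) (simp add: power2_norm_eq_inner algebra_simps inner_commute)
    also have "\<dots> \<le> e * norm (y - q)" using y by (intro mult_right_mono) (auto simp: dist_norm)
    finally show "(p - q) \<bullet> (y - q) \<le> e * norm (y - q)"
      using e by (smt (verit) mult_nonneg_nonneg norm_ge_zero)
  qed
qed fact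

lemma dir_limiting_normal_coneI:
  assumes "\<And>k. t k > 0" "t \<longlonglongrightarrow> 0" "(\<lambda>k. (1 / t k) *\<^sub>R (q k - y)) \<longlonglongrightarrow> u"
    "n \<longlonglongrightarrow> v" "\<And>k. n k \<in> frechet_normal_cone A (q k)"
  shows "v \<in> dir_limiting_normal_cone A y u"
proof -
  have "y + t k *\<^sub>R ((1 / t k) *\<^sub>R (q k - y)) = q k" for k
    using assms(1)[of k] by simp
  then show ?thesis
    unfolding dir_limiting_normal_cone_def using assms by force
qed

lemma cone_dir_limiting_normal_cone: "cone (dir_limiting_normal_cone A y u)"
  unfolding cone_def
proof (intro ballI allI impI)
  fix v and c :: real assume "v \<in> dir_limiting_normal_cone A y u" "c \<ge> 0"
  then obtain t uk vk where *: "\<forall>k. t k > 0" "t \<longlonglongrightarrow> 0" "uk \<longlonglongrightarrow> u" "vk \<longlonglongrightarrow> v"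
      "\<forall>k. vk k \<in> frechet_normal_cone A (y + t k *\<^sub>R uk k)"
    unfolding dir_limiting_normal_cone_def by blast
  have "(\<lambda>k. c *\<^sub>R vk k) \<longlonglongrightarrow> c *\<^sub>R v" using *(4) by (intro tendsto_intros)
  moreover have "\<forall>k. c *\<^sub>R vk k \<in> frechet_normal_cone A (y + t k *\<^sub>R uk k)"
    using *(5) \<open>c \<ge> 0\<close> by (simp add: frechet_normal_cone_scaleR)
  ultimately show "c *\<^sub>R v \<in> dir_limiting_normal_cone A y u"
    unfolding dir_limiting_normal_cone_def using * by blast
qed

text \<open>Membership of zero is not automatic: no Frechet normals exist off \<open>A\<close>, so
  the directional cone is empty unless points of \<open>A\<close> approach \<open>y\<close> in
  direction \<open>u\<close>.\<close>

lemma zero_mem_dir_limiting_normal_cone: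
  assumes "u \<in> tangent_cone A y"
  shows "0 \<in> dir_limiting_normal_cone A y u"
proof -
  obtain t uk where *: "\<forall>k. t k > 0" "t \<longlonglongrightarrow> 0" "uk \<longlonglongrightarrow> u" "\<forall>k. y + t k *\<^sub>R uk k \<in> A"
    using assms unfolding tangent_cone_def by blast
  have "\<forall>k. 0 \<in> frechet_normal_cone A (y + t k *\<^sub>R uk k)"
    using * by (simp add: mem_frechet_normal_cone_iff)
  moreover have "(\<lambda>k::nat. 0) \<longlonglongrightarrow> 0" by simp
  ultimately show ?thesis
    unfolding dir_limiting_normal_cone_def using * by blast
qed

lemma dir_limiting_subset_clarke: "dir_limiting_normal_cone A y u \<subseteq> dir_clarke_normal_cone A y u"
  unfolding dir_clarke_normal_cone_def using closure_subset hull_subset by fastforce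

lemma dir_clarke_normal_cone_facts:
  fixes A :: "'a::euclidean_space set"
  shows "closed (dir_clarke_normal_cone A y u)" "convex (dir_clarke_normal_cone A y u)"
    "cone (dir_clarke_normal_cone A y u)"
  unfolding dir_clarke_normal_cone_def
  by (auto intro: cone_closure cone_convex_hull cone_dir_limiting_normal_cone)

text \<open>Compactness of the unit sphere gives a limit of the normals, and the error bound makes
  their base points approach \<open>y\<close> in direction \<open>u\<close>. The predicate
  \<open>P\<close> is abstract so that any further property of the triples survives along the
  subsequence; both later contradiction arguments rely on this.\<close>

lemma unit_normals_subseq_limit:
  fixes K :: "'b::euclidean_space set" and t :: "nat \<Rightarrow> real"
  assumes "\<And>k. t k > 0" "t \<longlonglongrightarrow> 0"
    and freq: "\<exists>\<^sub>F k in sequentially. \<exists>q n. P k q n"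
    and normal: "\<And>k q n. P k q n \<Longrightarrow> n \<in> frechet_normal_cone K q \<and> norm n = 1"
    and appr: "\<And>k q n. P k q n \<Longrightarrow> norm (q - y - t k *\<^sub>R u) \<le> t k * e k" and "e \<longlonglongrightarrow> 0"
  obtains r q n v where "strict_mono r" "\<And>k. P (r k) (q k) (n k)" "n \<longlonglongrightarrow> v" "norm v = 1"
    "v \<in> dir_limiting_normal_cone K y u"
proof -
  have inf: "infinite {k. \<exists>q n. P k q n}"
    using freq by (simp add: frequently_cofinite flip: cofinite_eq_sequentially)
  define r0 where "r0 = enumerate {k. \<exists>q n. P k q n}"
  have r0: "strict_mono r0" "\<And>k. \<exists>q n. P (r0 k) q n"
    using inf enumerate_in_set[OF inf] by (auto simp: r0_def strict_mono_enumerate)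
  obtain q0 n0 where P0: "\<And>k. P (r0 k) (q0 k) (n0 k)"
    using r0(2) by metis
  have "\<forall>k. n0 k \<in> sphere 0 1" using normal[OF P0] by simp
  then obtain v r1 where r1: "v \<in> sphere 0 1" "strict_mono r1" "(n0 \<circ> r1) \<longlonglongrightarrow> v"
    using compact_sphere unfolding compact_def by blast
  define r where "r = r0 \<circ> r1"
  have r: "strict_mono r" unfolding r_def using r0 r1 by (simp add: strict_mono_o)
  have lim: "(\<lambda>k. (1 / t (r k)) *\<^sub>R ((q0 \<circ> r1) k - y)) \<longlonglongrightarrow> u"
  proof (rule metric_tendsto_imp_tendsto[of "\<lambda>k. e (r k)" 0])
    show "(\<lambda>k. e (r k)) \<longlonglongrightarrow> 0"
      using LIMSEQ_subseq_LIMSEQ[OF \<open>e \<longlonglongrightarrow> 0\<close> r] by (simp add: o_def)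
    have "dist ((1 / t (r k)) *\<^sub>R ((q0 \<circ> r1) k - y)) u \<le> dist (e (r k)) 0" for k
    proof -
      have tp: "t (r k) > 0" by fact
      have "(1 / t (r k)) *\<^sub>R ((q0 \<circ> r1) k - y) - u
          = (1 / t (r k)) *\<^sub>R (q0 (r1 k) - y - t (r k) *\<^sub>R u)"
        using tp by (simp add: scaleR_diff_right)
      then have "norm ((1 / t (r k)) *\<^sub>R ((q0 \<circ> r1) k - y) - u)
          = norm (q0 (r1 k) - y - t (r k) *\<^sub>R u) / t (r k)" using tp by simp
      also have "\<dots> \<le> e (r k)"
        using appr[OF P0[of "r1 k"]] tp by (simp add: r_def field_simps)
      finally show ?thesis by (simp add: dist_norm)
    qed
    then show "\<forall>\<^sub>F k in sequentially. dist ((1 / t (r k)) *\<^sub>R ((q0 \<circ> r1) k - y)) u \<le> dist (e (r k)) 0"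
      by simp
  qed
  have "v \<in> dir_limiting_normal_cone K y u"
  proof (rule dir_limiting_normal_coneI[OF _ _ lim r1(3)])
    show "(\<lambda>k. t (r k)) \<longlonglongrightarrow> 0"
      using LIMSEQ_subseq_LIMSEQ[OF \<open>t \<longlonglongrightarrow> 0\<close> r] by (simp add: o_def)
    show "(n0 \<circ> r1) k \<in> frechet_normal_cone K ((q0 \<circ> r1) k)" for k
      using normal[OF P0] by simp
  qed (use assms in auto)
  then show thesis
    using that[OF r, of "q0 \<circ> r1" "n0 \<circ> r1" v] P0 r1 by (auto simp: r_def)
qed

text \<open>Off a closed set the distance is positive, so the displacement from a nearest point can
  be normalised. This turns distance estimates into statements about unit normals.\<close>

lemma unit_normal_at_projection:
  fixes p :: "'b::euclidean_space"
  assumes "closed K" "K \<noteq> {}" "p \<notin> K"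
  obtains q n where "q \<in> K" "infdist p K = norm (p - q)" "p - q = infdist p K *\<^sub>R n" "norm n = 1"
    "n \<in> frechet_normal_cone K q" "infdist p K > 0"
proof -
  obtain q where q: "q \<in> K" "infdist p K = dist p q"
    using infdist_attains_inf[OF assms(1,2)] by blast
  have near: "dist p q \<le> dist p a" if "a \<in> K" for a
    using infdist_le[OF that, of p] q by simp
  have pos: "infdist p K > 0" using q assms(3) by auto
  show thesis
  proof (rule that[of q "(1 / infdist p K) *\<^sub>R (p - q)"])
    show "(1 / infdist p K) *\<^sub>R (p - q) \<in> frechet_normal_cone K q"
      using pos by (intro frechet_normal_cone_scaleR nearest_point_frechet_normal q near) auto
  qed (use q pos in \<open>auto simp: dist_norm\<close>)
qed

section \<open>Distance to a set along polar directions\<close>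

text \<open>The normal at a projection bounds the right derivative of the distance along the line, which
  is contradicted at the last point where the distance is at most \<open>\<epsilon> \<tau> + \<eta>\<close>; \<open>\<eta> > 0\<close> keeps that point
  off \<open>K\<close>.\<close>

lemma infdist_line_le_of_normals:
  fixes p z :: "'b::euclidean_space"
  assumes K: "closed K" "p \<in> K" and "\<epsilon> > 0" "s \<ge> 0"
    and slope: "\<And>\<tau> q n. \<lbrakk>0 \<le> \<tau>; \<tau> \<le> s; q \<in> K; n \<in> frechet_normal_cone K q; norm n = 1;
        norm (p + \<tau> *\<^sub>R z - q) \<le> \<tau> * norm z\<rbrakk> \<Longrightarrow> n \<bullet> z \<le> \<epsilon> / 2"
  shows "infdist (p + s *\<^sub>R z) K \<le> \<epsilon> * s"
proof (rule field_le_epsilon, rule ccontr)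
  fix \<eta> :: real assume "\<eta> > 0" and neg: "\<not> infdist (p + s *\<^sub>R z) K \<le> \<epsilon> * s + \<eta>"
  define \<phi> where "\<phi> \<tau> = infdist (p + \<tau> *\<^sub>R z) K" for \<tau>
  define Z where "Z = {\<tau> \<in> {0..s}. \<phi> \<tau> \<le> \<epsilon> * \<tau> + \<eta>}"
  have cont: "continuous_on UNIV \<phi>"
    unfolding \<phi>_def by (intro continuous_intros)
  have "closed {\<tau>. \<phi> \<tau> \<le> \<epsilon> * \<tau> + \<eta>}"
    by (intro closed_Collect_le cont continuous_intros)
  moreover have "Z = {0..s} \<inter> {\<tau>. \<phi> \<tau> \<le> \<epsilon> * \<tau> + \<eta>}" by (auto simp: Z_def)
  ultimately have "compact Z" by (simp add: compact_Int_closed)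
  moreover have "0 \<in> Z" using \<open>\<eta> > 0\<close> \<open>s \<ge> 0\<close> K by (simp add: Z_def \<phi>_def)
  ultimately obtain \<tau> where \<tau>: "\<tau> \<in> Z" "\<And>\<sigma>. \<sigma> \<in> Z \<Longrightarrow> \<sigma> \<le> \<tau>"
    by (metis compact_attains_sup empty_iff)
  have \<tau>s: "0 \<le> \<tau>" "\<tau> < s"
    using \<tau>(1) neg by (auto simp: Z_def \<phi>_def order_le_less)
  \<comment> \<open>Strict inequality at \<open>\<tau>\<close> would, by the intermediate value
    theorem, give a later point of \<open>Z\<close>, against maximality.\<close>
  have eq: "\<phi> \<tau> = \<epsilon> * \<tau> + \<eta>"
  proof (rule ccontr)
    assume "\<phi> \<tau> \<noteq> \<epsilon> * \<tau> + \<eta>"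
    then have "\<phi> \<tau> - \<epsilon> * \<tau> - \<eta> \<le> 0" "0 \<le> \<phi> s - \<epsilon> * s - \<eta>"
      using \<tau>(1) neg by (auto simp: Z_def \<phi>_def)
    moreover have "continuous_on {\<tau>..s} (\<lambda>\<sigma>. \<phi> \<sigma> - \<epsilon> * \<sigma> - \<eta>)"
      by (intro continuous_intros continuous_on_subset[OF cont]) auto
    ultimately obtain \<sigma> where \<sigma>: "\<tau> \<le> \<sigma>" "\<sigma> \<le> s" "\<phi> \<sigma> - \<epsilon> * \<sigma> - \<eta> = 0"
      using IVT'[of "\<lambda>\<sigma>. \<phi> \<sigma> - \<epsilon> * \<sigma> - \<eta>" \<tau> 0 s] \<tau>s by auto
    then have "\<sigma> \<in> Z" using \<tau>s by (simp add: Z_def)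
    then have "\<sigma> = \<tau>" using \<tau>(2) \<sigma> by force
    then show False using \<sigma> \<open>\<phi> \<tau> \<noteq> _\<close> by simp
  qed
  have pos: "\<phi> \<tau> > 0" using eq \<tau>s \<open>\<epsilon> > 0\<close> \<open>\<eta> > 0\<close> by (simp add: add_nonneg_pos)
  then have "p + \<tau> *\<^sub>R z \<notin> K" by (auto simp: \<phi>_def)
  then obtain q n where qn: "q \<in> K" "\<phi> \<tau> = norm (p + \<tau> *\<^sub>R z - q)" "p + \<tau> *\<^sub>R z - q = \<phi> \<tau> *\<^sub>R n"
      "norm n = 1" "n \<in> frechet_normal_cone K q"
    using unit_normal_at_projection[of K "p + \<tau> *\<^sub>R z"] K unfolding \<phi>_def by blast
  have "\<phi> \<tau> \<le> \<tau> * norm z"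
    using infdist_le[OF K(2), of "p + \<tau> *\<^sub>R z"] \<tau>s by (simp add: \<phi>_def dist_norm)
  then have nz: "n \<bullet> z \<le> \<epsilon> / 2"
    using slope[OF _ _ qn(1,5,4), of \<tau>] \<tau>s unfolding qn(2)[symmetric] by simp
  \<comment> \<open>The step is short enough to stay in the interval and to bound
    \<open>h * (norm z)\<^sup>2\<close> by \<open>\<epsilon> * \<phi> \<tau>\<close>; the 1 in the
    denominator covers \<open>z = 0\<close>.\<close>
  define h where "h = min (s - \<tau>) (\<epsilon> * \<phi> \<tau> / ((norm z)\<^sup>2 + 1))"
  have h: "h > 0" "h \<le> s - \<tau>"
    using \<tau>s pos \<open>\<epsilon> > 0\<close> by (auto simp: h_def intro!: divide_pos_pos add_nonneg_pos)
  have "h * ((norm z)\<^sup>2 + 1) \<le> \<epsilon> * \<phi> \<tau>"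
    unfolding h_def
    by (smt (verit) pos_le_divide_eq zero_le_power2 min.cobounded2)
  then have hz: "h * (norm z)\<^sup>2 \<le> \<epsilon> * \<phi> \<tau>" using h by (simp add: algebra_simps)
  have "(norm (\<phi> \<tau> *\<^sub>R n + h *\<^sub>R z))\<^sup>2 = (\<phi> \<tau>)\<^sup>2 + 2 * h * \<phi> \<tau> * (n \<bullet> z) + h * (h * (norm z)\<^sup>2)"
  proof -
    have "n \<bullet> n = 1" using qn(4) by (simp add: norm_eq_1)
    then show ?thesis
      unfolding power2_norm_eq_inner
      by (simp add: inner_add_left inner_add_right inner_commute algebra_simps power2_eq_square)
  qed
  \<comment> \<open>The slope term and the quadratic term each contribute
    \<open>\<epsilon> * h * \<phi> \<tau>\<close>, together the cross term of the square below. This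
    is why the slope is bounded by \<epsilon>/2 rather than \<epsilon>.\<close>
  also have "\<dots> \<le> (\<phi> \<tau>)\<^sup>2 + 2 * h * \<phi> \<tau> * (\<epsilon> / 2) + h * (\<epsilon> * \<phi> \<tau>)"
    using h pos nz hz by (intro add_mono mult_left_mono) auto
  also have "\<dots> \<le> (\<phi> \<tau> + \<epsilon> * h)\<^sup>2"
    using h \<open>\<epsilon> > 0\<close> by (simp add: power2_eq_square algebra_simps)
  finally have "norm (\<phi> \<tau> *\<^sub>R n + h *\<^sub>R z) \<le> \<phi> \<tau> + \<epsilon> * h"
    using pos h \<open>\<epsilon> > 0\<close> by (intro power2_le_imp_le[of "norm _"]) auto
  \<comment> \<open>The old projection \<open>q\<close> still bounds the distance from the new
    point.\<close>
  moreover have "\<phi> (\<tau> + h) \<le> norm (\<phi> \<tau> *\<^sub>R n + h *\<^sub>R z)"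
    using infdist_le[OF qn(1), of "p + (\<tau> + h) *\<^sub>R z"] unfolding qn(3)[symmetric]
    by (simp add: \<phi>_def dist_norm algebra_simps)
  ultimately have "\<phi> (\<tau> + h) \<le> \<epsilon> * (\<tau> + h) + \<eta>"
    using eq by (simp add: algebra_simps)
  then have "\<tau> + h \<in> Z" using h \<tau>s by (simp add: Z_def)
  then show False using \<tau>(2)[of "\<tau> + h"] h by simp
qed

text \<open>If the distance were not o(s), the previous lemma would supply, infinitely often, unit
  normals with slope along \<open>z\<close> bounded away from zero. Since \<open>s k / t k\<close>
  tends to 0, their base points still approach \<open>y\<close> in direction \<open>u\<close>, so a
  limit normal contradicts \<open>polar\<close>.\<close>

lemma infdist_polar_direction:
  fixes K :: "'b::euclidean_space set" and p :: "nat \<Rightarrow> 'b"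
  assumes K: "closed K" "\<And>k. p k \<in> K"
    and ts: "\<And>k. t k > 0" "\<And>k. s k > 0" "t \<longlonglongrightarrow> 0" "(\<lambda>k. s k / t k) \<longlonglongrightarrow> 0"
    and p: "(\<lambda>k. (1 / t k) *\<^sub>R (p k - y)) \<longlonglongrightarrow> u"
    and polar: "\<And>n. n \<in> dir_limiting_normal_cone K y u \<Longrightarrow> n \<bullet> z \<le> 0"
  shows "(\<lambda>k. infdist (p k + s k *\<^sub>R z) K / s k) \<longlonglongrightarrow> 0"
proof (rule tendstoI)
  fix \<epsilon>' :: real assume "\<epsilon>' > 0"
  define \<epsilon> where "\<epsilon> = \<epsilon>' / 2"
  have \<epsilon>: "\<epsilon> > 0" "\<epsilon> < \<epsilon>'" using \<open>\<epsilon>' > 0\<close> by (auto simp: \<epsilon>_def)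
  \<comment> \<open>The factor 2 adds the way from \<open>p k\<close> to a point of the line and
    from there to its projection, each at most \<open>s k * norm z\<close>.\<close>
  define P where "P k q n \<longleftrightarrow> q \<in> K \<and> n \<in> frechet_normal_cone K q \<and> norm n = 1 \<and>
      norm (p k - q) \<le> 2 * s k * norm z \<and> n \<bullet> z > \<epsilon> / 2" for k q n
  have "\<not> (\<exists>\<^sub>F k in sequentially. \<exists>q n. P k q n)"
  proof
    assume freq: "\<exists>\<^sub>F k in sequentially. \<exists>q n. P k q n"
    let ?e = "\<lambda>k. norm ((1 / t k) *\<^sub>R (p k - y) - u) + 2 * (s k / t k) * norm z"
    have e0: "?e \<longlonglongrightarrow> 0"
    proof -
      have "?e \<longlonglongrightarrow> norm (u - u) + 2 * 0 * norm z" by (intro tendsto_intros p ts)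
      then show ?thesis by simp
    qed
    have appr: "norm (q - y - t k *\<^sub>R u) \<le> t k * ?e k" if "P k q n" for k q n
    proof -
      have "norm (q - y - t k *\<^sub>R u) \<le> norm (q - p k) + norm (p k - y - t k *\<^sub>R u)"
        using norm_triangle_ineq[of "q - p k" "p k - y - t k *\<^sub>R u"] by (simp add: algebra_simps)
      also have "norm (p k - y - t k *\<^sub>R u) = t k * norm ((1 / t k) *\<^sub>R (p k - y) - u)"
      proof -
        have "p k - y - t k *\<^sub>R u = t k *\<^sub>R ((1 / t k) *\<^sub>R (p k - y) - u)"
          using ts(1)[of k] by (simp add: scaleR_diff_right)
        then show ?thesis using ts(1)[of k] by simp
      qed
      also have "norm (q - p k) \<le> 2 * s k * norm z"
        using that by (simp add: P_def norm_minus_commute)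
      finally show ?thesis using ts(1)[of k] by (simp add: distrib_left)
    qed
    obtain r q n v where *: "strict_mono r" "\<And>k. P (r k) (q k) (n k)" "n \<longlonglongrightarrow> v" "norm v = 1"
        "v \<in> dir_limiting_normal_cone K y u"
      by (rule unit_normals_subseq_limit[of t P K y u ?e, OF ts(1,3) freq _ appr e0]) (auto simp: P_def)
    have "(\<lambda>k. n k \<bullet> z) \<longlonglongrightarrow> v \<bullet> z" by (intro tendsto_intros *)
    then have "\<epsilon> / 2 \<le> v \<bullet> z"
      by (rule LIMSEQ_le_const) (use *(2) in \<open>auto simp: P_def intro!: less_imp_le\<close>)
    then show False using polar[OF *(5)] \<epsilon> by simp
  qed
  then have "\<forall>\<^sub>F k in sequentially. \<forall>q n. \<not> P k q n"
    by (simp add: not_frequently)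
  then show "\<forall>\<^sub>F k in sequentially. dist (infdist (p k + s k *\<^sub>R z) K / s k) 0 < \<epsilon>'"
  proof eventually_elim
    case (elim k)
    have "infdist (p k + s k *\<^sub>R z) K \<le> \<epsilon> * s k"
    proof (rule infdist_line_le_of_normals[OF K \<epsilon>(1) less_imp_le[OF ts(2)]])
      fix \<tau> q n assume a: "0 \<le> \<tau>" "\<tau> \<le> s k" "q \<in> K" "n \<in> frechet_normal_cone K q" "norm n = 1"
        "norm (p k + \<tau> *\<^sub>R z - q) \<le> \<tau> * norm z"
      have "norm (p k - q) \<le> norm (p k + \<tau> *\<^sub>R z - q) + norm (\<tau> *\<^sub>R z)"
        using norm_triangle_ineq4[of "p k + \<tau> *\<^sub>R z - q" "\<tau> *\<^sub>R z"] by (simp add: algebra_simps)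
      also have "\<dots> \<le> 2 * (\<tau> * norm z)" using a by simp
      also have "\<dots> \<le> 2 * (s k * norm z)" using a by (intro mult_left_mono mult_right_mono) auto
      finally show "n \<bullet> z \<le> \<epsilon> / 2" using elim a by (force simp: P_def not_less)
    qed
    then have "infdist (p k + s k *\<^sub>R z) K / s k \<le> \<epsilon>" using ts(2)[of k] by (simp add: field_simps)
    then show ?case using \<epsilon> ts(2)[of k] by (simp add: infdist_nonneg)
  qed
qed

section \<open>Conic duality\<close>

text \<open>The norm of \<open>A l\<close> attains a positive minimum on the compact set of unit
  vectors of \<open>N\<close>; homogeneity extends the bound to the whole cone.\<close>

lemma norm_pos_lower_bound_on_closed_cone:
  fixes A :: "'b::euclidean_space \<Rightarrow> 'a::real_normed_vector"
  assumes A: "bounded_linear A" and N: "closed N" "cone N"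
    and ker: "\<And>l. l \<in> N \<Longrightarrow> A l = 0 \<Longrightarrow> l = 0"
  obtains m where "m > 0" "\<And>l. l \<in> N \<Longrightarrow> m * norm l \<le> norm (A l)"
proof -
  interpret A: bounded_linear A by fact
  let ?C = "N \<inter> sphere 0 1"
  have "\<exists>m>0. \<forall>l\<in>?C. m \<le> norm (A l)"
  proof (cases "?C = {}")
    case False
    have "compact ?C" using N by (simp add: closed_Int_compact)
    moreover have "continuous_on ?C (\<lambda>l. norm (A l))"
      by (intro continuous_intros A.continuous_on)
    ultimately obtain l0 where "l0 \<in> ?C" "\<forall>l\<in>?C. norm (A l0) \<le> norm (A l)"
      using continuous_attains_inf[OF _ False] by blast
    then show ?thesis using ker[of l0] by (intro exI[of _ "norm (A l0)"]) auto
  qed (auto intro: exI[of _ 1])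
  then obtain m where m: "m > 0" "\<And>l. l \<in> ?C \<Longrightarrow> m \<le> norm (A l)" by blast
  have "m * norm l \<le> norm (A l)" if "l \<in> N" for l
  proof (cases "l = 0")
    case False
    have "(1 / norm l) *\<^sub>R l \<in> N" using that \<open>cone N\<close> by (simp add: cone_def)
    then have "m \<le> norm (A ((1 / norm l) *\<^sub>R l))" using False by (intro m) simp
    then show ?thesis using False by (simp add: A.scaleR field_simps)
  qed (simp add: A.zero)
  then show thesis using that m by blast
qed

text \<open>A separating hyperplane of a cone can be moved through the origin: the cone property
  rules out values of the wrong sign.\<close>

lemma separate_point_from_closed_cone:
  fixes M :: "'a::euclidean_space set"
  assumes "closed M" "convex M" "cone M" "0 \<in> M" "p \<notin> M"
  obtains a where "a \<bullet> p > 0" "\<And>x. x \<in> M \<Longrightarrow> a \<bullet> x \<le> 0"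
proof -
  obtain a b where ab: "a \<bullet> p < b" "\<forall>x\<in>M. a \<bullet> x > b"
    using separating_hyperplane_closed_point[OF assms(2,1,5)] by blast
  have b: "b < 0" using ab(2) assms(4) by force
  have "a \<bullet> x \<ge> 0" if "x \<in> M" for x
  proof (rule ccontr)
    assume neg: "\<not> a \<bullet> x \<ge> 0"
    then have "b / (a \<bullet> x) \<ge> 0" using b by (simp add: divide_nonpos_neg)
    \<comment> \<open>This multiple has inner product exactly \<open>b\<close> with
      \<open>a\<close>, which strict separation forbids.\<close>
    then have "(b / (a \<bullet> x)) *\<^sub>R x \<in> M" using that assms(3) by (simp add: cone_def)
    then have "b < (b / (a \<bullet> x)) * (a \<bullet> x)" using ab(2) by (metis inner_scaleR_right)
    then show False using neg by simp
  qed
  then show thesis using that[of "- a"] ab b by simp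
qed

text \<open>Strong duality with dual attainment for minimising \<open>F h\<close> subject to
  \<open>A h + b\<close> in the polar of \<open>N\<close>. The kernel condition makes the set of
  dual values closed; if it missed the wanted pair, a separating vector would yield a feasible
  \<open>h\<close> with \<open>F h < \<beta>\<close>.\<close>

lemma cone_program_multiplier:
  fixes A :: "'a::euclidean_space \<Rightarrow>\<^sub>L 'b::euclidean_space" and F :: "'a \<Rightarrow>\<^sub>L real"
  assumes N: "closed N" "convex N" "cone N" "0 \<in> N"
    and ker: "\<And>l. l \<in> N \<Longrightarrow> (\<And>h. l \<bullet> A h = 0) \<Longrightarrow> l = 0"
    and primal: "\<And>h. (\<And>l. l \<in> N \<Longrightarrow> l \<bullet> (A h + b) \<le> 0) \<Longrightarrow> F h \<ge> \<beta>"
  shows "\<exists>l\<in>N. (\<forall>h. F h + l \<bullet> A h = 0) \<and> l \<bullet> b \<ge> \<beta>"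
proof -
  define A' where "A' = adjoint (blinfun_apply A)"
  have linA: "linear (blinfun_apply A)" by (simp add: bounded_linear.linear[OF blinfun.bounded_linear_right])
  have adj: "h \<bullet> A' l = l \<bullet> A h" for h l
    using adjoint_works[OF linA, of h l] by (simp add: A'_def inner_commute)
  have A': "bounded_linear A'"
    unfolding A'_def using adjoint_linear[OF linA] by (simp add: linear_conv_bounded_linear)
  interpret A': bounded_linear A' by fact
  obtain m where m: "m > 0" "\<And>l. l \<in> N \<Longrightarrow> m * norm l \<le> norm (A' l)"
  proof (rule norm_pos_lower_bound_on_closed_cone[OF A' N(1,3)])
    show "l = 0" if "l \<in> N" "A' l = 0" for l
      using ker[OF that(1)] adj[of _ l] that(2) by simp
  qed blast
  \<comment> \<open>The slack \<open>s\<close> makes \<open>M\<close> closed downwards in its last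
    coordinate, so the goal becomes membership of \<open>(- F', \<beta>)\<close>, with
    \<open>F'\<close> the gradient of \<open>F\<close>.\<close>
  define M where "M = {(A' l, l \<bullet> b - s) | l s. l \<in> N \<and> s \<ge> 0}"
  have "closed M"
    unfolding closed_sequential_limits
  proof (intro allI impI, elim conjE)
    fix X P assume XM: "\<forall>k. X k \<in> M" and X: "X \<longlonglongrightarrow> P"
    have "\<forall>k. \<exists>l s. X k = (A' l, l \<bullet> b - s) \<and> l \<in> N \<and> s \<ge> 0" using XM by (auto simp: M_def)
    then obtain l s where ls: "\<And>k. X k = (A' (l k), l k \<bullet> b - s k)" "\<And>k. l k \<in> N" "\<And>k. s k \<ge> 0"
      by metis
    have lim: "(\<lambda>k. A' (l k)) \<longlonglongrightarrow> fst P" "(\<lambda>k. l k \<bullet> b - s k) \<longlonglongrightarrow> snd P"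
      using tendsto_fst[OF X] tendsto_snd[OF X] by (simp_all add: ls)
    obtain B where B: "\<And>k. norm (A' (l k)) \<le> B"
      using convergent_imp_bounded[OF lim(1)] by (auto simp: bounded_iff)
    \<comment> \<open>Closedness hinges on this bound: convergent images under \<open>A'\<close>
      come from bounded multipliers.\<close>
    have "norm (l k) \<le> B / m" for k
      using m(2)[OF ls(2)[of k]] B[of k] m(1) by (simp add: field_simps)
    then have "bounded (range l)" by (auto simp: bounded_iff)
    then obtain l' r where r: "strict_mono (r :: nat \<Rightarrow> nat)" "(l \<circ> r) \<longlonglongrightarrow> l'"
      using bounded_imp_convergent_subsequence by blast
    have "l' \<in> N" using N(1) r(2) ls(2) by (metis closed_sequentially comp_apply)
    have "(\<lambda>k. A' ((l \<circ> r) k)) \<longlonglongrightarrow> A' l'" by (intro A'.tendsto r)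
    moreover have "(\<lambda>k. A' ((l \<circ> r) k)) \<longlonglongrightarrow> fst P"
      using LIMSEQ_subseq_LIMSEQ[OF lim(1) r(1)] by (simp add: o_def)
    ultimately have 1: "fst P = A' l'" using LIMSEQ_unique by blast
    have "(\<lambda>k. (l \<circ> r) k \<bullet> b - (l (r k) \<bullet> b - s (r k))) \<longlonglongrightarrow> l' \<bullet> b - snd P"
      using LIMSEQ_subseq_LIMSEQ[OF lim(2) r(1)] by (intro tendsto_intros r) (simp add: o_def)
    then have "l' \<bullet> b - snd P \<ge> 0"
      by (rule LIMSEQ_le_const) (use ls in auto)
    then show "P \<in> M"
      unfolding M_def using 1 \<open>l' \<in> N\<close>
      by (intro CollectI exI[of _ l'] exI[of _ "l' \<bullet> b - snd P"]) (auto simp: prod_eq_iff)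
  qed
  have coneM: "cone M"
    unfolding cone_def
  proof (intro ballI allI impI)
    fix x and c :: real assume "x \<in> M" "c \<ge> 0"
    then obtain l s where "x = (A' l, l \<bullet> b - s)" "l \<in> N" "s \<ge> 0" by (auto simp: M_def)
    then show "c *\<^sub>R x \<in> M"
      unfolding M_def using \<open>c \<ge> 0\<close> N(3)
      by (intro CollectI exI[of _ "c *\<^sub>R l"] exI[of _ "c * s"]) (auto simp: cone_def A'.scaleR algebra_simps)
  qed
  have addN: "x + y \<in> N" if "x \<in> N" "y \<in> N" for x y
    using that N(2,3) convex_cone by blast
  have "x + y \<in> M" if "x \<in> M" "y \<in> M" for x y
  proof -
    obtain l s l' s' where "x = (A' l, l \<bullet> b - s)" "l \<in> N" "s \<ge> 0"
      "y = (A' l', l' \<bullet> b - s')" "l' \<in> N" "s' \<ge> 0" using \<open>x \<in> M\<close> \<open>y \<in> M\<close> by (auto simp: M_def)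
    then show ?thesis
      unfolding M_def using addN
      by (intro CollectI exI[of _ "l + l'"] exI[of _ "s + s'"]) (auto simp: A'.add algebra_simps)
  qed
  then have "convex M \<and> cone M" unfolding convex_cone using coneM by (simp add: cone_def)
  then have "convex M" ..
  have inM: "(A' l, l \<bullet> b - s) \<in> M" if "l \<in> N" "s \<ge> 0" for l s
    using that by (auto simp: M_def)
  have "0 \<in> M" using inM[OF N(4), of 0] by (simp add: A'.zero zero_prod_def)
  note sep = separate_point_from_closed_cone[OF \<open>closed M\<close> \<open>convex M\<close> coneM \<open>0 \<in> M\<close>]
  \<comment> \<open>Separating \<open>(0, 1)\<close> from \<open>M\<close> yields a feasible point \<open>h0\<close>, needed when the separator of
    \<open>(- F', \<beta>)\<close> is vertical.\<close>
  have "(0, 1) \<notin> M"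
  proof
    assume "(0, 1) \<in> M"
    then obtain l s where l: "A' l = 0" "l \<bullet> b - s = 1" "l \<in> N" "s \<ge> 0" by (auto simp: M_def)
    then have "l = 0" using ker[OF \<open>l \<in> N\<close>] adj[of _ l] by simp
    then show False using l by simp
  qed
  then obtain v where v: "v \<bullet> (0, 1) > 0" "\<And>x. x \<in> M \<Longrightarrow> v \<bullet> x \<le> 0" using sep by blast
  obtain h1 \<alpha>1 where "v = (h1, \<alpha>1)" by (cases v)
  define h0 where "h0 = (1 / \<alpha>1) *\<^sub>R h1"
  have \<alpha>1: "\<alpha>1 > 0" using v(1) \<open>v = _\<close> by simp
  have h0: "l \<bullet> (A h0 + b) \<le> 0" if "l \<in> N" for l
  proof -
    have "h1 \<bullet> A' l + \<alpha>1 * (l \<bullet> b) \<le> 0" using v(2)[OF inM[OF that, of 0]] \<open>v = _\<close> by simp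
    then have "l \<bullet> A h1 / \<alpha>1 + l \<bullet> b \<le> 0" using \<alpha>1 by (simp add: adj field_simps)
    then show ?thesis by (simp add: h0_def blinfun.scaleR_right inner_add_right)
  qed
  define F' where "F' = adjoint (blinfun_apply F) 1"
  have F': "h \<bullet> F' = F h" for h
    using adjoint_works[of "blinfun_apply F" h 1] by (simp add: F'_def bounded_linear.linear[OF blinfun.bounded_linear_right])
  have "(- F', \<beta>) \<in> M"
  proof (rule ccontr)
    assume "(- F', \<beta>) \<notin> M"
    then obtain v where v: "v \<bullet> (- F', \<beta>) > 0" "\<And>x. x \<in> M \<Longrightarrow> v \<bullet> x \<le> 0" using sep by blast
    obtain h \<alpha> where "v = (h, \<alpha>)" by (cases v)
    have less: "\<alpha> * \<beta> > F h" using v(1) \<open>v = _\<close> by (simp add: F')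
    \<comment> \<open>The separator is tested on (0, -1), which lies in \<open>M\<close> with
      \<open>l = 0\<close> and slack 1.\<close>
    have "\<alpha> \<ge> 0" using v(2)[OF inM[OF N(4), of 1]] \<open>v = _\<close> by (simp add: A'.zero)
    have le: "l \<bullet> A h + \<alpha> * (l \<bullet> b) \<le> 0" if "l \<in> N" for l
      using v(2)[OF inM[OF that, of 0]] \<open>v = _\<close> by (simp add: adj)
    show False
    proof (cases "\<alpha> = 0")
      case False
      then have "\<alpha> > 0" using \<open>\<alpha> \<ge> 0\<close> by simp
      have "F ((1 / \<alpha>) *\<^sub>R h) \<ge> \<beta>"
      proof (rule primal)
        fix l assume "l \<in> N"
        then have "l \<bullet> A h / \<alpha> + l \<bullet> b \<le> 0" using le \<open>\<alpha> > 0\<close> by (simp add: field_simps)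
        then show "l \<bullet> (A ((1 / \<alpha>) *\<^sub>R h) + b) \<le> 0" by (simp add: blinfun.scaleR_right inner_add_right)
      qed
      then show False using less \<open>\<alpha> > 0\<close> by (simp add: blinfun.scaleR_right field_simps)
    next
      case True
      then have neg: "F h < 0" using less by simp
      \<comment> \<open>Here \<open>h\<close> is a recession direction of the feasible set along
        which \<open>F\<close> decreases. A step of length \<open>c\<close> from \<open>h0\<close>
        brings \<open>F\<close> strictly below \<open>\<beta>\<close>.\<close>
      define c where "c = (\<bar>F h0\<bar> + \<bar>\<beta>\<bar> + 1) / (- F h)"
      have "c \<ge> 0" using neg by (simp add: c_def divide_nonneg_neg)
      have "F (h0 + c *\<^sub>R h) \<ge> \<beta>"
      proof (rule primal)
        fix l assume "l \<in> N"
        then have "l \<bullet> (A h0 + b) + c * (l \<bullet> A h) \<le> 0"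
          using h0 le[of l] True \<open>c \<ge> 0\<close> by (simp add: add_nonpos_nonpos mult_nonneg_nonpos)
        then show "l \<bullet> (A (h0 + c *\<^sub>R h) + b) \<le> 0"
          by (simp add: blinfun.add_right blinfun.scaleR_right inner_add_right)
      qed
      moreover have "c * F h = - (\<bar>F h0\<bar> + \<bar>\<beta>\<bar> + 1)" using neg by (simp add: c_def)
      ultimately show False by (simp add: blinfun.add_right blinfun.scaleR_right)
    qed
  qed
  then obtain l s where l: "- F' = A' l" "\<beta> = l \<bullet> b - s" "l \<in> N" "s \<ge> 0" by (auto simp: M_def)
  have "F h + l \<bullet> A h = 0" for h
  proof -
    have "F h + l \<bullet> A h = h \<bullet> F' + h \<bullet> A' l" by (simp add: F' adj)
    then show ?thesis by (simp flip: l(1))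
  qed
  then show ?thesis using l by force
qed

section \<open>Second-order expansions\<close>

text \<open>Restricting to the segment from \<open>x\<close> to \<open>x + v\<close> avoids the symmetry of the second derivative.\<close>

lemma second_order_remainder_bound:
  fixes g :: "'a::real_normed_vector \<Rightarrow> 'b::real_normed_vector"
  assumes g_D: "\<And>x. (g has_derivative blinfun_apply (Dg x)) (at x)"
    and g_D2: "(Dg has_derivative blinfun_apply D2) (at x)" and "e > 0"
  obtains \<rho> where "\<rho> > 0" "\<And>v. norm v < \<rho> \<Longrightarrow>
    norm (g (x + v) - g x - Dg x v - (1/2) *\<^sub>R D2 v v) \<le> e * (norm v)\<^sup>2"
proof -
  obtain \<rho> where \<rho>: "\<rho> > 0"
    "\<And>y. norm (y - x) < \<rho> \<Longrightarrow> norm (Dg y - Dg x - D2 (y - x)) \<le> e * norm (y - x)"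
    using g_D2 \<open>e > 0\<close> unfolding has_derivative_at_alt by blast
  have "norm (g (x + v) - g x - Dg x v - (1/2) *\<^sub>R D2 v v) \<le> e * (norm v)\<^sup>2" if v: "norm v < \<rho>" for v
  proof -
    \<comment> \<open>The quadratic Taylor terms are subtracted along the segment, so
      \<open>\<psi> 1 - \<psi> 0\<close> is the remainder, and the derivative of
      \<open>\<psi>\<close> is the first-order remainder of \<open>Dg\<close> applied to
      \<open>v\<close>.\<close>
    define \<psi> where "\<psi> \<tau> = g (x + \<tau> *\<^sub>R v) - \<tau> *\<^sub>R Dg x v - (\<tau>\<^sup>2 / 2) *\<^sub>R D2 v v" for \<tau>
    have der: "(\<psi> has_derivative (\<lambda>h. h *\<^sub>R (Dg (x + \<tau> *\<^sub>R v) v - Dg x v - \<tau> *\<^sub>R D2 v v)))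
        (at \<tau> within {0..1})" for \<tau>
    proof -
      have "((\<lambda>\<tau>. x + \<tau> *\<^sub>R v) has_derivative (\<lambda>h. h *\<^sub>R v)) (at \<tau> within {0..1})"
        by (auto intro!: derivative_eq_intros)
      then have "((\<lambda>\<tau>. g (x + \<tau> *\<^sub>R v)) has_derivative (\<lambda>h. Dg (x + \<tau> *\<^sub>R v) (h *\<^sub>R v)))
          (at \<tau> within {0..1})"
        by (rule has_derivative_compose[OF _ g_D])
      then show ?thesis
        unfolding \<psi>_def
        by (auto intro!: derivative_eq_intros simp: blinfun.scaleR_right algebra_simps)
    qed
    have "norm (\<psi> 1 - \<psi> 0) \<le> (e * (norm v)\<^sup>2) * norm (1 - 0 :: real)"
    proof (rule differentiable_bound[OF _ der])
      fix \<tau> :: real assume "\<tau> \<in> {0..1}"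
      then have \<tau>: "0 \<le> \<tau>" "\<tau> \<le> 1" by auto
      have nv: "norm (\<tau> *\<^sub>R v) \<le> norm v" using \<tau> by (simp add: mult_left_le_one_le)
      have "norm (Dg (x + \<tau> *\<^sub>R v) v - Dg x v - \<tau> *\<^sub>R D2 v v)
          = norm ((Dg (x + \<tau> *\<^sub>R v) - Dg x - D2 (\<tau> *\<^sub>R v)) v)"
        by (simp add: blinfun.diff_left blinfun.scaleR_right blinfun.scaleR_left)
      also have "\<dots> \<le> norm (Dg (x + \<tau> *\<^sub>R v) - Dg x - D2 (\<tau> *\<^sub>R v)) * norm v"
        by (rule norm_blinfun)
      also have "\<dots> \<le> (e * norm (\<tau> *\<^sub>R v)) * norm v"
        using \<rho>(2)[of "x + \<tau> *\<^sub>R v"] nv v by (intro mult_right_mono) auto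
      also have "\<dots> \<le> (e * norm v) * norm v"
        using nv \<open>e > 0\<close> by (intro mult_right_mono mult_left_mono) auto
      finally have *: "norm (Dg (x + \<tau> *\<^sub>R v) v - Dg x v - \<tau> *\<^sub>R D2 v v) \<le> e * (norm v)\<^sup>2"
        by (simp add: power2_eq_square mult.assoc)
      show "onorm (\<lambda>h. h *\<^sub>R (Dg (x + \<tau> *\<^sub>R v) v - Dg x v - \<tau> *\<^sub>R D2 v v)) \<le> e * (norm v)\<^sup>2"
      proof (rule onorm_le)
        fix h :: real
        show "norm (h *\<^sub>R (Dg (x + \<tau> *\<^sub>R v) v - Dg x v - \<tau> *\<^sub>R D2 v v)) \<le> e * (norm v)\<^sup>2 * norm h"
          using mult_right_mono[OF *, of "norm h"] by (simp add: mult.commute)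
      qed
    qed auto
    then show ?thesis by (simp add: \<psi>_def algebra_simps)
  qed
  then show thesis using that \<rho>(1) by blast
qed

text \<open>At scale \<open>s k\<close> the linear term in \<open>h k\<close> has weight 1 and the
  quadratic term weight \<open>(t k)\<^sup>2 / (2 * s k)\<close>, which tends to \<open>c\<close>.
  The increment is \<open>t k\<close> times a vector tending to \<open>d\<close>, so the Taylor
  remainder is o(t^2), hence o(s).\<close>

lemma second_order_expansion_seq:
  fixes g :: "'a::real_normed_vector \<Rightarrow> 'b::real_normed_vector" and t s :: "nat \<Rightarrow> real"
  assumes g_D: "\<And>x. (g has_derivative blinfun_apply (Dg x)) (at x)"
    and g_D2: "(Dg has_derivative blinfun_apply D2) (at x)"
    and ts: "\<And>k. t k > 0" "\<And>k. s k > 0" "t \<longlonglongrightarrow> 0" "(\<lambda>k. s k / t k) \<longlonglongrightarrow> 0"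
      "(\<lambda>k. (t k)\<^sup>2 / (2 * s k)) \<longlonglongrightarrow> c"
    and h: "h \<longlonglongrightarrow> h0"
  shows "(\<lambda>k. (1 / s k) *\<^sub>R (g (x + t k *\<^sub>R d + s k *\<^sub>R h k) - g x - t k *\<^sub>R Dg x d))
    \<longlonglongrightarrow> Dg x h0 + c *\<^sub>R D2 d d"
proof -
  define D where "D k = d + (s k / t k) *\<^sub>R h k" for k
  have "D \<longlonglongrightarrow> d + 0 *\<^sub>R h0" unfolding D_def by (intro tendsto_intros ts h)
  then have D: "D \<longlonglongrightarrow> d" by simp
  define v where "v k = t k *\<^sub>R d + s k *\<^sub>R h k" for k
  have vD: "v k = t k *\<^sub>R D k" for k
    using ts(1)[of k] by (simp add: v_def D_def algebra_simps)
  have "v \<longlonglongrightarrow> 0 *\<^sub>R d" unfolding vD by (intro tendsto_intros ts D)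
  then have v0: "v \<longlonglongrightarrow> 0" by simp
  define R where "R k = g (x + v k) - g x - Dg x (v k) - (1/2) *\<^sub>R D2 (v k) (v k)" for k
  have R: "(\<lambda>k. (1 / s k) *\<^sub>R R k) \<longlonglongrightarrow> 0"
  proof (rule tendstoI)
    fix e' :: real assume "e' > 0"
    \<comment> \<open>An eventual bound for \<open>(norm (v k))\<^sup>2 / s k\<close>, whose limit
      is \<open>B - 1\<close>.\<close>
    define B where "B = 2 * c * (norm d)\<^sup>2 + 1"
    have lim: "(\<lambda>k. 2 * ((t k)\<^sup>2 / (2 * s k)) * (norm (D k))\<^sup>2) \<longlonglongrightarrow> 2 * c * (norm d)\<^sup>2"
      by (intro tendsto_intros ts D)
    then have evB: "\<forall>\<^sub>F k in sequentially. 2 * ((t k)\<^sup>2 / (2 * s k)) * (norm (D k))\<^sup>2 < B"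
      by (rule order_tendstoD) (simp add: B_def)
    have "0 \<le> 2 * c * (norm d)\<^sup>2"
      by (rule LIMSEQ_le_const[OF lim]) (use ts(2) in \<open>auto simp: less_imp_le\<close>)
    then have "B > 0" by (simp add: B_def)
    define e where "e = e' / B"
    have "e > 0" using \<open>e' > 0\<close> \<open>B > 0\<close> by (simp add: e_def)
    obtain \<rho> where \<rho>: "\<rho> > 0" "\<And>v. norm v < \<rho> \<Longrightarrow>
        norm (g (x + v) - g x - Dg x v - (1/2) *\<^sub>R D2 v v) \<le> e * (norm v)\<^sup>2"
      using second_order_remainder_bound[OF g_D g_D2 \<open>e > 0\<close>] by blast
    have "\<forall>\<^sub>F k in sequentially. norm (v k) < \<rho>"
      using tendstoD[OF v0 \<rho>(1)] by simp
    then show "\<forall>\<^sub>F k in sequentially. dist ((1 / s k) *\<^sub>R R k) 0 < e'"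
      using evB
    proof eventually_elim
      case (elim k)
      have "norm (R k) \<le> e * (norm (v k))\<^sup>2" unfolding R_def using \<rho>(2) elim by blast
      then have "norm ((1 / s k) *\<^sub>R R k) \<le> e * (norm (v k))\<^sup>2 / s k"
        using ts(2)[of k] by (simp add: divide_right_mono)
      also have "\<dots> = e * (2 * ((t k)\<^sup>2 / (2 * s k)) * (norm (D k))\<^sup>2)"
        using ts(1,2)[of k] by (simp add: vD power_mult_distrib)
      also have "\<dots> < e * B" using elim \<open>e > 0\<close> by (intro mult_strict_left_mono) auto
      also have "\<dots> = e'" using \<open>B > 0\<close> by (simp add: e_def)
      finally show ?case by simp
    qed
  qed
  have eq: "(1 / s k) *\<^sub>R (g (x + t k *\<^sub>R d + s k *\<^sub>R h k) - g x - t k *\<^sub>R Dg x d)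
      = Dg x (h k) + ((t k)\<^sup>2 / (2 * s k)) *\<^sub>R D2 (D k) (D k) + (1 / s k) *\<^sub>R R k" for k
  proof -
    have "g (x + t k *\<^sub>R d + s k *\<^sub>R h k) - g x - t k *\<^sub>R Dg x d
        = s k *\<^sub>R Dg x (h k) + (1/2) *\<^sub>R D2 (v k) (v k) + R k"
      by (simp add: R_def v_def add.assoc blinfun.add_right blinfun.scaleR_right)
    also have "(1/2) *\<^sub>R D2 (v k) (v k) = ((t k)\<^sup>2 / 2) *\<^sub>R D2 (D k) (D k)"
      by (simp add: vD blinfun.scaleR_right blinfun.scaleR_left power2_eq_square)
    finally show ?thesis using ts(2)[of k] by (simp add: scaleR_add_right)
  qed
  have "(\<lambda>k. Dg x (h k) + ((t k)\<^sup>2 / (2 * s k)) *\<^sub>R D2 (D k) (D k) + (1 / s k) *\<^sub>R R k)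
      \<longlonglongrightarrow> Dg x h0 + c *\<^sub>R D2 d d + 0"
    by (intro tendsto_intros ts R h D)
  then show ?thesis by (simp add: eq)
qed

text \<open>Frechet differentiability gives the directional derivative even when the direction
  varies and converges to \<open>d\<close>.\<close>

lemma has_derivative_seq_quotient:
  fixes g :: "'a::real_normed_vector \<Rightarrow> 'b::real_normed_vector"
  assumes g: "(g has_derivative g') (at x)" and t: "\<And>k. t k > (0::real)" "t \<longlonglongrightarrow> 0"
    and X: "(\<lambda>k. (1 / t k) *\<^sub>R (X k - x)) \<longlonglongrightarrow> d"
  shows "(\<lambda>k. (1 / t k) *\<^sub>R (g (X k) - g x)) \<longlonglongrightarrow> g' d"
proof -
  interpret g': bounded_linear g' using g by (rule has_derivative_bounded_linear)
  let ?D = "\<lambda>k. (1 / t k) *\<^sub>R (X k - x)"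
  have XD: "X k - x = t k *\<^sub>R ?D k" for k using t(1)[of k] by simp
  have "(\<lambda>k. t k *\<^sub>R ?D k) \<longlonglongrightarrow> 0 *\<^sub>R d" by (intro tendsto_intros t X)
  then have X0: "(\<lambda>k. X k - x) \<longlonglongrightarrow> 0" unfolding XD[symmetric] by simp
  have R: "(\<lambda>k. (1 / t k) *\<^sub>R (g (X k) - g x - g' (X k - x))) \<longlonglongrightarrow> 0"
  proof (rule tendstoI)
    fix e' :: real assume "e' > 0"
    define e where "e = e' / (norm d + 1)"
    have "norm d + 1 > 0" by (simp add: add_nonneg_pos)
    then have "e > 0" using \<open>e' > 0\<close> by (simp add: e_def)
    then obtain \<rho> where \<rho>: "\<rho> > 0"
      "\<And>y. norm (y - x) < \<rho> \<Longrightarrow> norm (g y - g x - g' (y - x)) \<le> e * norm (y - x)"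
      using g unfolding has_derivative_at_alt by blast
    have "\<forall>\<^sub>F k in sequentially. norm (X k - x) < \<rho>" using tendstoD[OF X0 \<rho>(1)] by simp
    moreover have "\<forall>\<^sub>F k in sequentially. norm (?D k) < norm d + 1"
      by (rule order_tendstoD[OF tendsto_norm[OF X]]) simp
    ultimately show "\<forall>\<^sub>F k in sequentially. dist ((1 / t k) *\<^sub>R (g (X k) - g x - g' (X k - x))) 0 < e'"
    proof eventually_elim
      case (elim k)
      have "norm ((1 / t k) *\<^sub>R (g (X k) - g x - g' (X k - x))) \<le> e * norm (X k - x) / t k"
        using \<rho>(2)[OF elim(1)] t(1)[of k] by (simp add: divide_right_mono)
      also have "\<dots> = e * norm (?D k)" using t(1)[of k] by simp
      also have "\<dots> < e * (norm d + 1)" using elim(2) \<open>e > 0\<close> by (rule mult_strict_left_mono)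
      also have "\<dots> = e'" using \<open>norm d + 1 > 0\<close> by (simp add: e_def)
      finally show ?case by simp
    qed
  qed
  have "(\<lambda>k. (1 / t k) *\<^sub>R (g (X k) - g x - g' (X k - x)) + g' (?D k)) \<longlonglongrightarrow> 0 + g' d"
    by (intro tendsto_add R g'.tendsto X)
  moreover have "(1 / t k) *\<^sub>R (g (X k) - g x - g' (X k - x)) + g' (?D k)
      = (1 / t k) *\<^sub>R (g (X k) - g x)" for k
    unfolding g'.scaleR by (simp flip: scaleR_add_right)
  ultimately show ?thesis by simp
qed

section \<open>Tangents of the solution set\<close>

text \<open>If the bound failed infinitely often, the nearest points in \<open>S\<close>, recentred
  at \<open>x\<close> and divided by \<open>t\<close>, would accumulate at a tangent vector within
  \<open>z\<close> times the tangent distance of \<open>d\<close>. The factor \<open>z < 1\<close>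
  makes this contradictory.\<close>

lemma infdist_ge_tangent_distance:
  fixes S :: "'a::euclidean_space set"
  assumes S: "closed S" "S \<noteq> {}" and t: "\<And>k. t k > (0::real)" "t \<longlonglongrightarrow> 0"
    and X: "(\<lambda>k. (1 / t k) *\<^sub>R (X k - x)) \<longlonglongrightarrow> d" and z: "0 < z" "z < 1"
  shows "\<forall>\<^sub>F k in sequentially. z * infdist d (tangent_cone S x) \<le> infdist (X k) S / t k"
proof (rule ccontr)
  assume neg: "\<not> ?thesis"
  define a where "a = infdist d (tangent_cone S x)"
  have fr: "\<exists>\<^sub>F k in sequentially. infdist (X k) S / t k < z * a"
    using neg by (simp add: not_eventually a_def not_le)
  define I where "I = {k. infdist (X k) S / t k < z * a}"
  have inf: "infinite I"
    using fr by (simp add: I_def frequently_cofinite flip: cofinite_eq_sequentially)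
  define r where "r = enumerate I"
  have r: "strict_mono r" "\<And>k. r k \<in> I"
    using inf by (simp_all add: r_def strict_mono_enumerate enumerate_in_set)
  have "\<forall>k. \<exists>y\<in>S. infdist (X (r k)) S = dist (X (r k)) y"
    using infdist_attains_inf[OF S] by blast
  then obtain y where y: "\<And>k. y k \<in> S" "\<And>k. infdist (X (r k)) S = dist (X (r k)) (y k)" by metis
  define D where "D k = (1 / t k) *\<^sub>R (X k - x)" for k
  define E where "E k = (1 / t (r k)) *\<^sub>R (y k - x)" for k
  have DE: "norm (E k - D (r k)) \<le> z * a" for k
  proof -
    have "E k - D (r k) = (1 / t (r k)) *\<^sub>R (y k - X (r k))"
      by (simp add: E_def D_def flip: scaleR_diff_right)
    then have "norm (E k - D (r k)) = infdist (X (r k)) S / t (r k)"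
      using t(1)[of "r k"] by (simp add: y dist_norm norm_minus_commute)
    then show ?thesis using r(2)[of k] by (simp add: I_def)
  qed
  have Dr: "(\<lambda>k. D (r k)) \<longlonglongrightarrow> d"
    using LIMSEQ_subseq_LIMSEQ[OF X r(1)] by (simp add: o_def D_def)
  obtain B where B: "\<And>k. norm (D (r k)) \<le> B"
    using convergent_imp_bounded[OF Dr] by (auto simp: bounded_iff)
  have "norm (E k) \<le> z * a + B" for k
    using norm_triangle_ineq[of "E k - D (r k)" "D (r k)"] DE[of k] B[of k] by simp
  then have "bounded (range E)" by (auto simp: bounded_iff)
  then obtain e r' where r': "strict_mono (r' :: nat \<Rightarrow> nat)" "(E \<circ> r') \<longlonglongrightarrow> e"
    using bounded_imp_convergent_subsequence by blast
  have rr: "strict_mono (r \<circ> r')" using r(1) r'(1) by (rule strict_mono_o)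
  have "e \<in> tangent_cone S x"
    unfolding tangent_cone_def
  proof (intro CollectI exI[of _ "t \<circ> (r \<circ> r')"] exI[of _ "E \<circ> r'"] conjI)
    show "(t \<circ> (r \<circ> r')) \<longlonglongrightarrow> 0" by (rule LIMSEQ_subseq_LIMSEQ[OF t(2) rr])
    have "x + t (r j) *\<^sub>R E j = y j" for j using t(1)[of "r j"] by (simp add: E_def)
    then show "\<forall>k. x + (t \<circ> (r \<circ> r')) k *\<^sub>R (E \<circ> r') k \<in> S" using y(1) by simp
  qed (use t(1) r' in auto)
  moreover have "norm (e - d) \<le> z * a"
  proof (rule LIMSEQ_le_const2)
    have "(\<lambda>k. D (r (r' k))) \<longlonglongrightarrow> d" using LIMSEQ_subseq_LIMSEQ[OF Dr r'(1)] by (simp add: o_def)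
    then show "(\<lambda>k. norm ((E \<circ> r') k - D (r (r' k)))) \<longlonglongrightarrow> norm (e - d)"
      by (intro tendsto_intros r')
  qed (use DE in auto)
  ultimately have "a \<le> z * a"
    unfolding a_def using infdist_le[of e "tangent_cone S x" d] by (simp add: dist_norm norm_minus_commute)
  \<comment> \<open>A nonnegative quotient lies strictly below \<open>z * a\<close>, so the failure
    itself excludes \<open>a = 0\<close>.\<close>
  moreover have "0 < z * a"
  proof -
    have "0 \<le> infdist (X (r 0)) S / t (r 0)" using t(1)[of "r 0"] by (simp add: infdist_nonneg)
    then show ?thesis using r(2)[of 0] by (simp add: I_def)
  qed
  ultimately show False using z by (simp add: zero_less_mult_iff)
qed

lemma zero_mem_tangent_cone: "x \<in> S \<Longrightarrow> 0 \<in> tangent_cone S x"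
  unfolding tangent_cone_def
  by (intro CollectI exI[of _ "\<lambda>k. inverse (real (Suc k))"] exI[of _ "\<lambda>k. 0"] conjI
      LIMSEQ_inverse_real_of_nat) auto

text \<open>Squaring the nearest-point inequality along a tangent sequence bounds
  \<open>2 * \<tau> * (v \<bullet> u k)\<close> by a term that vanishes with
  \<open>t k\<close>.\<close>

lemma proximal_normal_inner_tangent_le:
  fixes v :: "'a::real_inner"
  assumes "v \<in> proximal_normal_cone S x" "e \<in> tangent_cone S x"
  shows "v \<bullet> e \<le> 0"
proof -
  obtain \<tau> where \<tau>: "\<tau> > 0" "\<forall>a\<in>S. dist (x + \<tau> *\<^sub>R v) x \<le> dist (x + \<tau> *\<^sub>R v) a"
    using assms(1) unfolding proximal_normal_cone_def by blast
  obtain t u where t: "\<forall>k. t k > 0" "t \<longlonglongrightarrow> 0" "u \<longlonglongrightarrow> e" "\<forall>k. x + t k *\<^sub>R u k \<in> S"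
    using assms(2) unfolding tangent_cone_def by blast
  have "2 * \<tau> * (v \<bullet> u k) \<le> t k * (norm (u k))\<^sup>2" for k
  proof -
    have "norm (\<tau> *\<^sub>R v) \<le> norm (\<tau> *\<^sub>R v - t k *\<^sub>R u k)"
      using \<tau>(2)[rule_format, of "x + t k *\<^sub>R u k"] t(4) by (simp add: dist_norm)
    then have "(norm (\<tau> *\<^sub>R v))\<^sup>2 \<le> (norm (\<tau> *\<^sub>R v - t k *\<^sub>R u k))\<^sup>2" by (simp add: power_mono)
    then have "t k * (2 * \<tau> * (v \<bullet> u k)) \<le> t k * (t k * (norm (u k))\<^sup>2)"
      unfolding power2_norm_eq_inner
      by (simp add: inner_diff_left inner_diff_right inner_commute algebra_simps)
    then show ?thesis using t(1) by simp
  qed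
  moreover have "(\<lambda>k. 2 * \<tau> * (v \<bullet> u k)) \<longlonglongrightarrow> 2 * \<tau> * (v \<bullet> e)" by (intro tendsto_intros t)
  moreover have "(\<lambda>k. t k * (norm (u k))\<^sup>2) \<longlonglongrightarrow> 0 * (norm e)\<^sup>2" by (intro tendsto_intros t)
  ultimately have "2 * \<tau> * (v \<bullet> e) \<le> 0 * (norm e)\<^sup>2" by (intro LIMSEQ_le) auto
  then show ?thesis using \<tau>(1) by (simp add: mult_le_0_iff)
qed

text \<open>For a proximal normal \<open>v\<close> near \<open>d\<close> and a tangent
  \<open>e\<close>, the sign of <v, e> gives |v| \<le> |d - e| + |d - v|. Passing from |v| back to
  |d| costs |d - v| once more, whence the factor 2 before \<epsilon>.\<close>

lemma eps_proximal_normal_infdist_tangent: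
  fixes d :: "'a::real_inner"
  assumes "x \<in> S" "d \<in> eps_proximal_normal_cone \<epsilon> S x"
  shows "(1 - 2 * \<epsilon>) * norm d \<le> infdist d (tangent_cone S x)"
proof -
  have T: "tangent_cone S x \<noteq> {}" using zero_mem_tangent_cone[OF assms(1)] by blast
  have "0 \<in> proximal_normal_cone S x"
    using assms(1) by (auto simp: proximal_normal_cone_def intro: exI[of _ 1])
  then have N: "proximal_normal_cone S x \<noteq> {}" by blast
  show ?thesis
  proof (rule field_le_epsilon)
    fix \<eta> :: real assume "\<eta> > 0"
    \<comment> \<open>The distance to the proximal normal cone may not be attained; the margin
      \<eta>/2 enters twice in the final bound.\<close>
    define b where "b = \<epsilon> * norm d + \<eta> / 2"
    have "infdist d (proximal_normal_cone S x) < b"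
      using assms(2) \<open>\<eta> > 0\<close> by (simp add: eps_proximal_normal_cone_def b_def)
    then obtain v where v: "v \<in> proximal_normal_cone S x" "norm (d - v) < b"
      using cInf_lessD[of "dist d ` proximal_normal_cone S x" b] N
      by (auto simp: infdist_notempty dist_norm)
    have "norm d - 2 * b \<le> norm (d - e)" if e: "e \<in> tangent_cone S x" for e
    proof (cases "v = 0")
      case True
      then show ?thesis using v(2) norm_ge_zero[of "d - e"] norm_ge_zero[of d] by (simp del: norm_ge_zero)
    next
      case False
      have "norm v * norm v = d \<bullet> v - (d - v) \<bullet> v"
        by (simp add: inner_diff_left flip: power2_eq_square power2_norm_eq_inner)
      also have "\<dots> \<le> (d - e) \<bullet> v + norm (d - v) * norm v"
        using proximal_normal_inner_tangent_le[OF v(1) e] Cauchy_Schwarz_ineq2[of "d - v" v]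
        unfolding inner_diff_left[of d e] inner_commute[of v e] by linarith
      also have "\<dots> \<le> norm (d - e) * norm v + b * norm v"
        using norm_cauchy_schwarz[of "d - e" v] v(2) by (intro add_mono mult_right_mono) auto
      finally have "norm v \<le> norm (d - e) + b" using False by (simp flip: distrib_right)
      then show ?thesis using norm_triangle_ineq2[of d v] v(2) by simp
    qed
    then have "norm d - 2 * b \<le> infdist d (tangent_cone S x)"
      unfolding infdist_notempty[OF T] by (intro cINF_greatest T) (simp add: dist_norm)
    then show "(1 - 2 * \<epsilon>) * norm d \<le> infdist d (tangent_cone S x) + \<eta>"
      by (simp add: b_def algebra_simps)
  qed
qed

section \<open>Directional metric subregularity\<close>

text \<open>The norm has gradient \<open>n\<close> at \<open>g x' - q\<close>, and the penalty
  changes at rate at most \<open>a\<close>. A slope of \<open>n \<bullet> g' h\<close> below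
  \<open>- a * norm h\<close> would make the penalised function decrease along
  \<open>h\<close>.\<close>

lemma penalised_minimiser_normal:
  fixes g :: "'a::real_normed_vector \<Rightarrow> 'b::real_inner"
  assumes g: "(g has_derivative g') (at x')" and "a \<ge> 0" "\<rho> > 0"
    and q: "g x' - q = \<mu> *\<^sub>R n" "\<mu> > 0" "norm n = 1"
    and min: "\<And>y. norm (y - x') < \<rho> \<Longrightarrow>
      norm (g x' - q) + a * norm (x' - xs) \<le> norm (g y - q) + a * norm (y - xs)"
  shows "n \<bullet> g' h \<ge> - a * norm h"
proof (rule ccontr)
  assume neg: "\<not> n \<bullet> g' h \<ge> - a * norm h"
  \<comment> \<open>The increase of the penalty is replaced by its linear upper bound, so that
    \<open>\<psi>\<close> is differentiable at 0 even if \<open>x' = xs\<close>.\<close>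
  define \<psi> where "\<psi> \<tau> = norm (g (x' + \<tau> *\<^sub>R h) - q) + \<tau> * (a * norm h)" for \<tau>
  interpret g': bounded_linear g' using g by (rule has_derivative_bounded_linear)
  have "((\<lambda>\<tau>. x' + \<tau> *\<^sub>R h) has_derivative (\<lambda>\<sigma>. \<sigma> *\<^sub>R h)) (at 0)"
    by (auto intro!: derivative_eq_intros)
  then have "((\<lambda>\<tau>. g (x' + \<tau> *\<^sub>R h)) has_derivative (\<lambda>\<sigma>. g' (\<sigma> *\<^sub>R h))) (at 0)"
    using has_derivative_compose[of "\<lambda>\<tau>. x' + \<tau> *\<^sub>R h" _ 0 UNIV g g'] g by simp
  then have 1: "((\<lambda>\<tau>. g (x' + \<tau> *\<^sub>R h) - q) has_derivative (\<lambda>\<sigma>. g' (\<sigma> *\<^sub>R h))) (at 0)"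
    by (auto intro!: derivative_eq_intros)
  have ne: "g x' - q \<noteq> 0" using q by auto
  have sgn: "sgn (g x' - q) = n" using q by (simp add: sgn_div_norm)
  have "((\<lambda>\<tau>. norm (g (x' + \<tau> *\<^sub>R h) - q)) has_derivative (\<lambda>\<sigma>. g' (\<sigma> *\<^sub>R h) \<bullet> n)) (at 0)"
    using has_derivative_compose[OF 1, of norm "\<lambda>y. y \<bullet> n"] has_derivative_norm[OF ne] by (simp add: sgn)
  then have "(\<psi> has_derivative (\<lambda>\<sigma>. g' (\<sigma> *\<^sub>R h) \<bullet> n + \<sigma> * (a * norm h))) (at 0)"
    unfolding \<psi>_def by (auto intro!: derivative_eq_intros)
  then have "(\<psi> has_real_derivative (n \<bullet> g' h + a * norm h)) (at 0)"
    unfolding has_field_derivative_def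
    by (rule has_derivative_eq_rhs) (auto simp: g'.scaleR fun_eq_iff inner_commute algebra_simps)
  then obtain \<sigma> where \<sigma>: "\<sigma> > 0" "\<And>\<tau>. \<lbrakk>\<tau> > 0; \<tau> < \<sigma>\<rbrakk> \<Longrightarrow> \<psi> \<tau> < \<psi> 0"
    using has_real_derivative_neg_dec_right[of \<psi> "n \<bullet> g' h + a * norm h" 0 UNIV] neg by auto
  define \<tau> where "\<tau> = min (\<sigma> / 2) (\<rho> / (2 * (norm h + 1)))"
  have h1: "norm h + 1 > 0" by (simp add: add_nonneg_pos)
  have \<tau>: "\<tau> > 0" "\<tau> < \<sigma>" using \<sigma>(1) \<open>\<rho> > 0\<close> h1 by (auto simp: \<tau>_def)
  have "\<tau> * (norm h + 1) \<le> \<rho> / (2 * (norm h + 1)) * (norm h + 1)"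
    using h1 by (intro mult_right_mono) (auto simp: \<tau>_def)
  also have "\<dots> = \<rho> / 2" using h1 by (simp add: field_simps)
  finally have "\<tau> * norm h < \<rho>" using \<tau> \<open>\<rho> > 0\<close> by (simp add: algebra_simps)
  then have "norm (g x' - q) + a * norm (x' - xs)
      \<le> norm (g (x' + \<tau> *\<^sub>R h) - q) + a * norm (x' + \<tau> *\<^sub>R h - xs)"
    using \<tau> by (intro min) simp
  moreover have "norm (x' + \<tau> *\<^sub>R h - xs) \<le> norm (x' - xs) + \<tau> * norm h"
    using norm_triangle_ineq[of "x' - xs" "\<tau> *\<^sub>R h"] \<tau> by (simp add: algebra_simps)
  then have "a * norm (x' + \<tau> *\<^sub>R h - xs) \<le> a * (norm (x' - xs) + \<tau> * norm h)"
    using \<open>a \<ge> 0\<close> by (rule mult_left_mono)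
  ultimately have "norm (g x' - q) \<le> \<psi> \<tau>" by (simp add: \<psi>_def algebra_simps)
  then show False using \<sigma>(2)[OF \<tau>] by (simp add: \<psi>_def)
qed

text \<open>A minimiser of \<open>dist(g y, K) + a |y - X\<^sub>k|\<close> is feasible for small \<open>a\<close>: otherwise unit normals \<open>n\<close> at the
  projections satisfy \<open>|\<nabla>g\<^sup>T n| \<le> a\<close> and accumulate at a violation of DirRCQ.\<close>

lemma directional_metric_subregularity:
  fixes g :: "'a::euclidean_space \<Rightarrow> 'b::euclidean_space" and Dg :: "'a \<Rightarrow> 'a \<Rightarrow>\<^sub>L 'b"
    and t :: "nat \<Rightarrow> real"
  assumes g_D: "\<And>x. (g has_derivative blinfun_apply (Dg x)) (at x)" and Dg: "isCont Dg x"
    and K: "closed K" "K \<noteq> {}"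
    and rcq: "DirRCQ Dg g K x d"
    and t: "\<And>k. t k > 0" "t \<longlonglongrightarrow> 0"
    and X: "(\<lambda>k. (1 / t k) *\<^sub>R (X k - x)) \<longlonglongrightarrow> d"
    and small: "(\<lambda>k. infdist (g (X k)) K / t k) \<longlonglongrightarrow> 0"
  obtains a where "a > 0"
    "\<forall>\<^sub>F k in sequentially. \<exists>x'. g x' \<in> K \<and> a * norm (x' - X k) \<le> infdist (g (X k)) K"
proof -
  define N where "N = dir_clarke_normal_cone K (g x) (Dg x d)"
  define A' where "A' = adjoint (blinfun_apply (Dg x))"
  have linA: "linear (blinfun_apply (Dg x))" by (simp add: bounded_linear.linear[OF blinfun.bounded_linear_right])
  have adj: "h \<bullet> A' l = l \<bullet> Dg x h" for h l
    using adjoint_works[OF linA, of h l] by (simp add: A'_def inner_commute)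
  have A': "bounded_linear A'"
    unfolding A'_def using adjoint_linear[OF linA] by (simp add: linear_conv_bounded_linear)
  obtain m where m: "m > 0" "\<And>l. l \<in> N \<Longrightarrow> m * norm l \<le> norm (A' l)"
  proof (rule norm_pos_lower_bound_on_closed_cone[OF A'])
    show "closed N" "cone N" unfolding N_def by (rule dir_clarke_normal_cone_facts)+
    show "l = 0" if "l \<in> N" "A' l = 0" for l
      using rcq adj[of _ l] that unfolding DirRCQ_def N_def by simp
  qed blast
  \<comment> \<open>Any value strictly below \<open>m\<close> works: a unit limit normal in
    \<open>N\<close> has adjoint image of norm at least \<open>m\<close>, but the minimisers will
    only allow \<open>a\<close>.\<close>
  define a where "a = m / 2"
  have "a > 0" using m by (simp add: a_def)
  define \<eta> where "\<eta> k = infdist (g (X k)) K" for k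
  have \<eta>0: "\<eta> k \<ge> 0" for k by (simp add: \<eta>_def infdist_nonneg)
  have contg: "continuous_on UNIV g"
    using g_D by (meson continuous_at_imp_continuous_on has_derivative_continuous)
  define F where "F k y = infdist (g y) K + a * norm (y - X k)" for k y
  \<comment> \<open>A minimiser lies within \<open>\<eta> k / a\<close> of \<open>X k\<close>; the
    extra 1 keeps the unit ball around it inside the compact domain, so it is a local minimiser of
    the unrestricted function.\<close>
  have "\<exists>x'\<in>cball (X k) (\<eta> k / a + 1). \<forall>y\<in>cball (X k) (\<eta> k / a + 1). F k x' \<le> F k y" for k
  proof (rule continuous_attains_inf)
    show "cball (X k) (\<eta> k / a + 1) \<noteq> {}"
      using \<eta>0[of k] \<open>a > 0\<close> by (simp add: not_less divide_nonneg_pos add_nonneg_nonneg)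
    show "continuous_on (cball (X k) (\<eta> k / a + 1)) (F k)"
      unfolding F_def by (intro continuous_intros continuous_on_subset[OF contg]) auto
  qed simp
  then obtain Y where Y: "\<And>k y. norm (y - X k) \<le> \<eta> k / a + 1 \<Longrightarrow> F k (Y k) \<le> F k y"
    unfolding mem_cball dist_norm Ball_def Bex_def norm_minus_commute[of "X _"] by metis
  have FY: "F k (Y k) \<le> \<eta> k" for k
    using Y[of "X k" k] \<eta>0[of k] \<open>a > 0\<close> by (simp add: F_def \<eta>_def)
  have YX: "a * norm (Y k - X k) \<le> \<eta> k" for k
    using FY[of k] infdist_nonneg[of "g (Y k)" K] by (simp add: F_def)
  have gY: "infdist (g (Y k)) K \<le> \<eta> k" for k
    using FY[of k] \<open>a > 0\<close> by (simp add: F_def) (smt (verit) mult_nonneg_nonneg norm_ge_zero)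
  \<comment> \<open>The correction is o(t), so the minimisers still approach \<open>x\<close> in
    direction \<open>d\<close>.\<close>
  have YXt: "(\<lambda>k. (1 / t k) *\<^sub>R (Y k - X k)) \<longlonglongrightarrow> 0"
  proof (rule Lim_null_comparison)
    show "(\<lambda>k. \<eta> k / t k / a) \<longlonglongrightarrow> 0"
      using tendsto_divide[OF small tendsto_const[of a]] \<open>a > 0\<close> by (simp add: \<eta>_def)
    show "\<forall>\<^sub>F k in sequentially. norm ((1 / t k) *\<^sub>R (Y k - X k)) \<le> \<eta> k / t k / a"
    proof (intro always_eventually allI)
      fix k
      have "norm (Y k - X k) \<le> \<eta> k / a" using YX[of k] \<open>a > 0\<close> by (simp add: field_simps)
      then have "norm (Y k - X k) / t k \<le> \<eta> k / a / t k"
        using t(1)[of k] by (intro divide_right_mono) auto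
      then show "norm ((1 / t k) *\<^sub>R (Y k - X k)) \<le> \<eta> k / t k / a"
        using t(1)[of k] by (simp add: mult.commute)
    qed
  qed
  have Yd: "(\<lambda>k. (1 / t k) *\<^sub>R (Y k - x)) \<longlonglongrightarrow> d"
    using tendsto_add[OF YXt X] by (simp flip: scaleR_add_right)
  have Yx: "Y \<longlonglongrightarrow> x"
  proof -
    have "(\<lambda>k. x + t k *\<^sub>R ((1 / t k) *\<^sub>R (Y k - x))) \<longlonglongrightarrow> x + 0 *\<^sub>R d" by (intro tendsto_intros t Yd)
    moreover have "x + t k *\<^sub>R ((1 / t k) *\<^sub>R (Y k - x)) = Y k" for k using t(1)[of k] by simp
    ultimately show ?thesis by simp
  qed
  have gYd: "(\<lambda>k. (1 / t k) *\<^sub>R (g (Y k) - g x)) \<longlonglongrightarrow> Dg x d"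
    by (rule has_derivative_seq_quotient[OF g_D t Yd])
  define P where "P k q n \<longleftrightarrow> n \<in> frechet_normal_cone K q \<and> norm n = 1 \<and>
    norm (g (Y k) - q) \<le> \<eta> k \<and> (\<forall>h. n \<bullet> Dg (Y k) h \<ge> - a * norm h)" for k q n
  have P: "\<exists>q n. P k q n" if "g (Y k) \<notin> K" for k
  proof -
    obtain q n where qn: "q \<in> K" "infdist (g (Y k)) K = norm (g (Y k) - q)"
        "g (Y k) - q = infdist (g (Y k)) K *\<^sub>R n" "norm n = 1"
        "n \<in> frechet_normal_cone K q" "infdist (g (Y k)) K > 0"
      using unit_normal_at_projection[OF K \<open>g (Y k) \<notin> K\<close>] by blast
    have "n \<bullet> Dg (Y k) h \<ge> - a * norm h" for h
    proof (rule penalised_minimiser_normal[OF g_D _ zero_less_one qn(3,6,4)])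
      fix y assume y: "norm (y - Y k) < 1"
      have "norm (Y k - X k) \<le> \<eta> k / a" using YX[of k] \<open>a > 0\<close> by (simp add: field_simps)
      then have "norm (y - X k) \<le> \<eta> k / a + 1"
        using norm_triangle_ineq[of "y - Y k" "Y k - X k"] y by simp
      then have "F k (Y k) \<le> F k y" by (rule Y)
      \<comment> \<open>The projection \<open>q\<close> can be frozen: \<open>norm (g y - q)\<close>
        dominates the distance to \<open>K\<close>, with equality at \<open>Y k\<close>.\<close>
      then show "norm (g (Y k) - q) + a * norm (Y k - X k) \<le> norm (g y - q) + a * norm (y - X k)"
        using infdist_le[OF qn(1), of "g y"] unfolding F_def qn(2) by (simp add: dist_norm)
    qed (use \<open>a > 0\<close> in simp)
    then have "P k q n" unfolding P_def using qn(4,5) gY[of k, unfolded qn(2)] by blast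
    then show ?thesis by blast
  qed
  have "\<not> (\<exists>\<^sub>F k in sequentially. \<exists>q n. P k q n)"
  proof
    assume freq: "\<exists>\<^sub>F k in sequentially. \<exists>q n. P k q n"
    let ?e = "\<lambda>k. norm ((1 / t k) *\<^sub>R (g (Y k) - g x) - Dg x d) + \<eta> k / t k"
    have "?e \<longlonglongrightarrow> norm (Dg x d - Dg x d) + 0"
      using small by (intro tendsto_intros gYd) (simp add: \<eta>_def)
    then have e0: "?e \<longlonglongrightarrow> 0" by simp
    have appr: "norm (q - g x - t k *\<^sub>R Dg x d) \<le> t k * ?e k" if "P k q n" for k q n
    proof -
      have "norm (q - g x - t k *\<^sub>R Dg x d)
          \<le> norm (q - g (Y k)) + norm (g (Y k) - g x - t k *\<^sub>R Dg x d)"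
        using norm_triangle_ineq[of "q - g (Y k)" "g (Y k) - g x - t k *\<^sub>R Dg x d"]
        by (simp add: algebra_simps)
      also have "norm (g (Y k) - g x - t k *\<^sub>R Dg x d)
          = t k * norm ((1 / t k) *\<^sub>R (g (Y k) - g x) - Dg x d)"
      proof -
        have "g (Y k) - g x - t k *\<^sub>R Dg x d = t k *\<^sub>R ((1 / t k) *\<^sub>R (g (Y k) - g x) - Dg x d)"
          using t(1)[of k] by (simp add: scaleR_diff_right)
        then show ?thesis using t(1)[of k] by simp
      qed
      also have "norm (q - g (Y k)) \<le> \<eta> k" using that by (simp add: P_def norm_minus_commute)
      finally show ?thesis using t(1)[of k] by (simp add: distrib_left)
    qed
    obtain r q n v where *: "strict_mono r" "\<And>k. P (r k) (q k) (n k)" "n \<longlonglongrightarrow> v" "norm v = 1"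
        "v \<in> dir_limiting_normal_cone K (g x) (Dg x d)"
      by (rule unit_normals_subseq_limit[of t P K "g x" "Dg x d" ?e, OF t freq _ appr e0])
        (auto simp: P_def)
    have Yr: "(\<lambda>k. Y (r k)) \<longlonglongrightarrow> x" using LIMSEQ_subseq_LIMSEQ[OF Yx *(1)] by (simp add: o_def)
    have lower: "v \<bullet> Dg x h \<ge> - a * norm h" for h
    proof (rule LIMSEQ_le_const)
      show "(\<lambda>k. n k \<bullet> Dg (Y (r k)) h) \<longlonglongrightarrow> v \<bullet> Dg x h"
        by (intro tendsto_intros * isCont_tendsto_compose[OF Dg Yr])
    qed (use *(2) in \<open>auto simp: P_def\<close>)
    \<comment> \<open>The lower bound is tested in the direction of steepest descent,
      \<open>- A' v\<close>.\<close>
    have "norm (A' v) * norm (A' v) \<le> a * norm (A' v)"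
      using lower[of "- A' v"] adj[of "- A' v" v]
      by (simp flip: power2_eq_square power2_norm_eq_inner)
    then have "norm (A' v) \<le> a" using \<open>a > 0\<close> by (cases "A' v = 0") auto
    moreover have "m \<le> norm (A' v)"
      using m(2)[of v] *(4,5) dir_limiting_subset_clarke unfolding N_def by fastforce
    ultimately show False using m by (simp add: a_def)
  qed
  then have "\<forall>\<^sub>F k in sequentially. \<forall>q n. \<not> P k q n" by (simp add: not_frequently)
  then have "\<forall>\<^sub>F k in sequentially. \<exists>x'. g x' \<in> K \<and> a * norm (x' - X k) \<le> infdist (g (X k)) K"
  proof eventually_elim
    case (elim k)
    then show ?case using P[of k] YX[of k] by (auto simp: \<eta>_def intro!: exI[of _ "Y k"])
  qed
  then show thesis using that \<open>a > 0\<close> by blast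
qed

section \<open>Second-order multipliers\<close>

text \<open>The factor \<open>c\<close> stands on both sides so that \<open>c = 0\<close> removes
  the Hessian and growth terms together, leaving only the sign condition on
  \<open>l \<bullet> w0\<close>.\<close>

lemma second_order_multiplier:
  fixes f :: "'a::euclidean_space \<Rightarrow> real" and g :: "'a \<Rightarrow> 'b::euclidean_space"
    and t s :: "nat \<Rightarrow> real"
  assumes f_D: "\<And>x. (f has_derivative blinfun_apply (Df x)) (at x)"
    and f_D2: "(Df has_derivative blinfun_apply (D2f x)) (at x)"
    and g_D: "\<And>x. (g has_derivative blinfun_apply (Dg x)) (at x)"
    and g_D2: "(Dg has_derivative blinfun_apply (D2g x)) (at x)"
    and K: "closed K" and \<kappa>: "\<kappa> \<ge> 0"
    and wsm: "local_2nd_order_weak_sharp_min f g K xb \<kappa> \<delta>"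
    and x: "x \<in> optimal_set f g K \<inter> ball xb \<delta>" and d: "d \<in> critical_cone Df Dg g K x"
    and rcq: "DirRCQ Dg g K x d"
    and ts: "\<And>k. t k > 0" "\<And>k. s k > 0" "t \<longlonglongrightarrow> 0" "(\<lambda>k. s k / t k) \<longlonglongrightarrow> 0"
      "(\<lambda>k. (t k)\<^sup>2 / (2 * s k)) \<longlonglongrightarrow> c"
    and w: "w \<longlonglongrightarrow> w0" and mem: "\<And>k. g x + t k *\<^sub>R Dg x d + s k *\<^sub>R w k \<in> K"
  shows "\<exists>l\<in>dir_C_multipliers Df Dg g K x d.
    c * hessL_dd D2f D2g x l d - l \<bullet> w0
      \<ge> c * (2 * \<kappa> * (infdist d (tangent_cone (optimal_set f g K) x))\<^sup>2)"
proof -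
  define S where "S = optimal_set f g K"
  define N where "N = dir_clarke_normal_cone K (g x) (Dg x d)"
  define \<gamma> where "\<gamma> = 2 * \<kappa> * (infdist d (tangent_cone S x))\<^sup>2"
  define b where "b = c *\<^sub>R D2g x d d - w0"
  have u: "Dg x d \<in> tangent_cone K (g x)" and Dfd: "Df x d \<le> 0"
    using d by (auto simp: critical_cone_def)
  have xS: "x \<in> S" using x by (simp add: S_def)
  then have "g x \<in> K" by (simp add: S_def optimal_set_def feasible_set_def)
  then have "K \<noteq> {}" by blast
  have contg: "continuous_on UNIV g" and contf: "continuous_on UNIV f"
    using g_D f_D by (meson continuous_at_imp_continuous_on has_derivative_continuous)+
  have closedS: "closed S"
  proof -
    have "S = g -` K \<inter> (\<Inter>y\<in>feasible_set g K. {z. f z \<le> f y})"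
      by (auto simp: S_def optimal_set_def feasible_set_def)
    moreover have "closed (g -` K)"
      using K contg by (simp add: continuous_on_closed_vimage)
    ultimately show ?thesis
      by (auto intro!: closed_Int closed_INT closed_Collect_le contf continuous_intros)
  qed
  \<comment> \<open>Growth is assumed relative to \<open>f xb\<close>; optimality of
    \<open>x\<close> gives \<open>f x \<le> f xb\<close>, so it holds relative to \<open>f x\<close>
    too.\<close>
  have growth: "f y \<ge> f x + \<kappa> * (infdist y S)\<^sup>2" if "g y \<in> K" "y \<in> ball xb \<delta>" for y
  proof -
    have xb: "xb \<in> feasible_set g K"
      and wsm': "\<And>y. y \<in> feasible_set g K \<inter> ball xb \<delta> \<Longrightarrow> f y \<ge> f xb + \<kappa> * (infdist y S)\<^sup>2"
      using wsm unfolding local_2nd_order_weak_sharp_min_def S_def by auto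
    have "f x \<le> f xb" using x xb by (auto simp: optimal_set_def)
    moreover have "f y \<ge> f xb + \<kappa> * (infdist y S)\<^sup>2"
      using that by (intro wsm') (simp add: feasible_set_def)
    ultimately show ?thesis by simp
  qed
  have s0: "s \<longlonglongrightarrow> 0"
  proof -
    have "(\<lambda>k. s k / t k * t k) \<longlonglongrightarrow> 0 * 0" by (intro tendsto_mult ts)
    moreover have "s k / t k * t k = s k" for k using ts(1)[of k] by simp
    ultimately show ?thesis by simp
  qed
  \<comment> \<open>The value bound of the conic program: \<open>h\<close> is any feasible point,
    and a genuinely feasible curve with this second-order direction is built.\<close>
  have primal: "Df x h \<ge> c * (\<gamma> - D2f x d d)" if polar: "\<And>l. l \<in> N \<Longrightarrow> l \<bullet> (Dg x h + b) \<le> 0" for h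
  proof -
    define z where "z = Dg x h + b"
    define X where "X k = x + t k *\<^sub>R d + s k *\<^sub>R h" for k
    define p where "p k = g x + t k *\<^sub>R Dg x d + s k *\<^sub>R w k" for k
    have pu: "(\<lambda>k. (1 / t k) *\<^sub>R (p k - g x)) \<longlonglongrightarrow> Dg x d"
    proof -
      have "(\<lambda>k. Dg x d + (s k / t k) *\<^sub>R w k) \<longlonglongrightarrow> Dg x d + 0 *\<^sub>R w0"
        by (intro tendsto_intros ts w)
      moreover have "(1 / t k) *\<^sub>R (p k - g x) = Dg x d + (s k / t k) *\<^sub>R w k" for k
        using ts(1)[of k] by (simp add: p_def scaleR_add_right)
      ultimately show ?thesis by simp
    qed
    have A: "(\<lambda>k. infdist (p k + s k *\<^sub>R z) K / s k) \<longlonglongrightarrow> 0"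
    proof (rule infdist_polar_direction[OF K _ ts(1-4) pu])
      show "n \<bullet> z \<le> 0" if "n \<in> dir_limiting_normal_cone K (g x) (Dg x d)" for n
        using polar[of n] that dir_limiting_subset_clarke unfolding N_def z_def by blast
    qed (use mem in \<open>simp add: p_def\<close>)
    define G where "G k = (1 / s k) *\<^sub>R (g (X k) - g x - t k *\<^sub>R Dg x d)" for k
    have "G \<longlonglongrightarrow> Dg x h + c *\<^sub>R D2g x d d"
      unfolding G_def X_def by (rule second_order_expansion_seq[OF g_D g_D2 ts tendsto_const])
    then have "(\<lambda>k. G k - w k - z) \<longlonglongrightarrow> Dg x h + c *\<^sub>R D2g x d d - w0 - z"
      by (intro tendsto_intros w)
    then have Gz: "(\<lambda>k. G k - w k - z) \<longlonglongrightarrow> 0" by (simp add: z_def b_def)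
    \<comment> \<open>The image of the trial curve \<open>X\<close> is the given curve
      \<open>p\<close> in \<open>K\<close>, moved by \<open>s k\<close> in the polar direction
      \<open>z\<close>, up to o(s).\<close>
    have gX: "g (X k) = p k + s k *\<^sub>R z + s k *\<^sub>R (G k - w k - z)" for k
      using ts(2)[of k] by (simp add: G_def p_def scaleR_diff_right algebra_simps)
    have Xs: "(\<lambda>k. infdist (g (X k)) K / s k) \<longlonglongrightarrow> 0"
    proof (rule Lim_null_comparison)
      show "(\<lambda>k. infdist (p k + s k *\<^sub>R z) K / s k + norm (G k - w k - z)) \<longlonglongrightarrow> 0"
        using tendsto_add[OF A tendsto_norm_zero[OF Gz]] by simp
      show "\<forall>\<^sub>F k in sequentially. norm (infdist (g (X k)) K / s k)
          \<le> infdist (p k + s k *\<^sub>R z) K / s k + norm (G k - w k - z)"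
      proof (intro always_eventually allI)
        fix k
        have "infdist (g (X k)) K \<le> infdist (p k + s k *\<^sub>R z) K + dist (g (X k)) (p k + s k *\<^sub>R z)"
          by (rule infdist_triangle)
        also have "dist (g (X k)) (p k + s k *\<^sub>R z) = s k * norm (G k - w k - z)"
          using ts(2)[of k] unfolding gX by (simp add: dist_norm)
        finally show "norm (infdist (g (X k)) K / s k)
            \<le> infdist (p k + s k *\<^sub>R z) K / s k + norm (G k - w k - z)"
          using ts(2)[of k] by (simp add: infdist_nonneg field_simps)
      qed
    qed
    have Xt: "(\<lambda>k. infdist (g (X k)) K / t k) \<longlonglongrightarrow> 0"
    proof -
      have "(\<lambda>k. infdist (g (X k)) K / s k * (s k / t k)) \<longlonglongrightarrow> 0 * 0" by (intro tendsto_mult Xs ts)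
      moreover have eq: "infdist (g (X k)) K / s k * (s k / t k) = infdist (g (X k)) K / t k" for k
        using ts(2)[of k] by simp
      ultimately show ?thesis by (simp only: eq mult_zero_left)
    qed
    have quot: "(\<lambda>k. (1 / t k) *\<^sub>R (x + t k *\<^sub>R d + s k *\<^sub>R H k - x)) \<longlonglongrightarrow> d" if "H \<longlonglongrightarrow> h" for H
    proof -
      have "(\<lambda>k. d + (s k / t k) *\<^sub>R H k) \<longlonglongrightarrow> d + 0 *\<^sub>R h" by (intro tendsto_intros ts that)
      moreover have "(1 / t k) *\<^sub>R (x + t k *\<^sub>R d + s k *\<^sub>R H k - x) = d + (s k / t k) *\<^sub>R H k" for k
        using ts(1)[of k] by (simp add: scaleR_add_right)
      ultimately show ?thesis by simp
    qed
    have Xd: "(\<lambda>k. (1 / t k) *\<^sub>R (X k - x)) \<longlonglongrightarrow> d"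
      unfolding X_def by (rule quot) simp
    have contDg: "isCont Dg x" using g_D2 by (rule has_derivative_continuous)
    obtain a where a: "a > 0"
        "\<forall>\<^sub>F k in sequentially. \<exists>x'. g x' \<in> K \<and> a * norm (x' - X k) \<le> infdist (g (X k)) K"
      using directional_metric_subregularity[OF g_D contDg K \<open>K \<noteq> {}\<close> rcq ts(1,3) Xd Xt] by blast
    \<comment> \<open>Corrected points exist only for large \<open>k\<close>; the choice is
      arbitrary before that.\<close>
    define Y where "Y k = (SOME x'. g x' \<in> K \<and> a * norm (x' - X k) \<le> infdist (g (X k)) K)" for k
    have Y: "\<forall>\<^sub>F k in sequentially. g (Y k) \<in> K \<and> a * norm (Y k - X k) \<le> infdist (g (X k)) K"
      using a(2) by eventually_elim (unfold Y_def, rule someI_ex)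
    \<comment> \<open>The o(s) correction is absorbed into the second-order direction, so the
      expansion of \<open>f\<close> applies along the feasible points \<open>Y k\<close> with the
      same limit \<open>h\<close>.\<close>
    define H where "H k = h + (1 / s k) *\<^sub>R (Y k - X k)" for k
    have YH: "Y k = x + t k *\<^sub>R d + s k *\<^sub>R H k" for k
      using ts(2)[of k] by (simp add: H_def X_def scaleR_add_right)
    have "(\<lambda>k. (1 / s k) *\<^sub>R (Y k - X k)) \<longlonglongrightarrow> 0"
    proof (rule Lim_null_comparison)
      show "(\<lambda>k. infdist (g (X k)) K / s k / a) \<longlonglongrightarrow> 0"
        using tendsto_divide[OF Xs tendsto_const[of a]] a(1) by simp
      show "\<forall>\<^sub>F k in sequentially. norm ((1 / s k) *\<^sub>R (Y k - X k)) \<le> infdist (g (X k)) K / s k / a"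
        using Y
      proof eventually_elim
        case (elim k)
        then have "norm (Y k - X k) \<le> infdist (g (X k)) K / a" using a(1) by (simp add: field_simps)
        then have "norm (Y k - X k) / s k \<le> infdist (g (X k)) K / a / s k"
          using ts(2)[of k] by (intro divide_right_mono) auto
        then show ?case using ts(2)[of k] by (simp add: mult.commute)
      qed
    qed
    then have Hh: "H \<longlonglongrightarrow> h" unfolding H_def by (rule tendsto_add[OF tendsto_const, where b=0, simplified])
    have Yx: "Y \<longlonglongrightarrow> x"
    proof -
      have "Y \<longlonglongrightarrow> x + 0 *\<^sub>R d + 0 *\<^sub>R h" unfolding YH by (intro tendsto_intros ts s0 Hh)
      then show ?thesis by simp
    qed
    have Yball: "\<forall>\<^sub>F k in sequentially. Y k \<in> ball xb \<delta>"
      using x by (intro topological_tendstoD[OF Yx]) auto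
    define Q where "Q k = (1 / s k) * (f (Y k) - f x - t k * Df x d)" for k
    have Q: "Q \<longlonglongrightarrow> Df x h + c * D2f x d d"
      using second_order_expansion_seq[OF f_D f_D2 ts Hh, of d] by (simp add: Q_def[abs_def] YH)
    \<comment> \<open>The tangent distance is controlled only up to a factor below 1. It gets
      squared, so \<open>sqrt r\<close> is used, and then \<open>r\<close> tends to 1.\<close>
    have "r * (c * \<gamma>) \<le> Df x h + c * D2f x d d" if r: "0 < r" "r < 1" for r
    proof -
      let ?a = "infdist d (tangent_cone S x)"
      have "\<forall>\<^sub>F k in sequentially. sqrt r * ?a \<le> infdist (Y k) S / t k"
        using quot[OF Hh] r xS closedS ts(1,3)
        by (intro infdist_ge_tangent_distance) (auto simp: YH)
      then have "\<forall>\<^sub>F k in sequentially. 2 * \<kappa> * (r * ?a\<^sup>2) * ((t k)\<^sup>2 / (2 * s k)) \<le> Q k"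
        using Y Yball
      proof eventually_elim
        case (elim k)
        have "sqrt r * ?a * t k \<le> infdist (Y k) S"
          using elim(1) ts(1)[of k] by (simp add: field_simps)
        then have "(sqrt r * ?a * t k)\<^sup>2 \<le> (infdist (Y k) S)\<^sup>2"
          using r ts(1)[of k] by (intro power_mono) (auto simp: infdist_nonneg intro!: mult_nonneg_nonneg)
        then have "\<kappa> * (r * ?a\<^sup>2 * (t k)\<^sup>2) \<le> \<kappa> * (infdist (Y k) S)\<^sup>2"
          using r \<kappa> by (intro mult_left_mono) (auto simp: power_mult_distrib)
        also have "\<dots> \<le> f (Y k) - f x" using growth elim by fastforce
        \<comment> \<open>Criticality of \<open>d\<close> lets the first-order term be subtracted at
          no loss.\<close>
        also have "\<dots> \<le> f (Y k) - f x - t k * Df x d"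
          using Dfd ts(1)[of k] by (simp add: mult_nonneg_nonpos)
        finally show ?case using ts(2)[of k] by (simp add: Q_def field_simps)
      qed
      moreover have "(\<lambda>k. 2 * \<kappa> * (r * ?a\<^sup>2) * ((t k)\<^sup>2 / (2 * s k))) \<longlonglongrightarrow> 2 * \<kappa> * (r * ?a\<^sup>2) * c"
        by (intro tendsto_intros ts)
      ultimately have "2 * \<kappa> * (r * ?a\<^sup>2) * c \<le> Df x h + c * D2f x d d"
        using tendsto_le[OF sequentially_bot Q] by blast
      then show ?thesis by (simp add: \<gamma>_def mult_ac)
    qed
    then have "c * \<gamma> \<le> Df x h + c * D2f x d d" by (rule field_le_mult_one_interval)
    then show ?thesis by (simp add: algebra_simps)
  qed
  have "\<exists>l\<in>N. (\<forall>h. Df x h + l \<bullet> Dg x h = 0) \<and> l \<bullet> b \<ge> c * (\<gamma> - D2f x d d)"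
  proof (rule cone_program_multiplier)
    show "closed N" "convex N" "cone N" unfolding N_def by (rule dir_clarke_normal_cone_facts)+
    show "0 \<in> N"
      using zero_mem_dir_limiting_normal_cone[OF u] dir_limiting_subset_clarke unfolding N_def by blast
    show "l = 0" if "l \<in> N" "\<And>h. l \<bullet> Dg x h = 0" for l
      using rcq that unfolding DirRCQ_def N_def by blast
  qed (rule primal)
  then obtain l where l: "l \<in> N" "\<And>h. Df x h + l \<bullet> Dg x h = 0" "l \<bullet> b \<ge> c * (\<gamma> - D2f x d d)" by blast
  show ?thesis
  proof (rule bexI[of _ l])
    show "l \<in> dir_C_multipliers Df Dg g K x d" using l by (simp add: dir_C_multipliers_def N_def)
    show "c * hessL_dd D2f D2g x l d - l \<bullet> w0
        \<ge> c * (2 * \<kappa> * (infdist d (tangent_cone (optimal_set f g K) x))\<^sup>2)"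
      using l(3) unfolding S_def[symmetric] \<gamma>_def[symmetric]
      by (simp add: hessL_dd_def b_def inner_diff_right algebra_simps)
  qed
qed

section \<open>Specialisation to the asymptotic and ordinary second-order tangent sets\<close>

theorem theorem3p9:
  fixes f :: "'a::euclidean_space \<Rightarrow> real" and g :: "'a \<Rightarrow> 'b::euclidean_space"
    and Df :: "'a \<Rightarrow> 'a \<Rightarrow>\<^sub>L real" and D2f :: "'a \<Rightarrow> 'a \<Rightarrow>\<^sub>L 'a \<Rightarrow>\<^sub>L real"
    and Dg :: "'a \<Rightarrow> 'a \<Rightarrow>\<^sub>L 'b" and D2g :: "'a \<Rightarrow> 'a \<Rightarrow>\<^sub>L 'a \<Rightarrow>\<^sub>L 'b"
    and K :: "'b set" and xb :: 'a and \<kappa> \<delta> :: real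
  assumes f_D: "\<And>x. (f has_derivative blinfun_apply (Df x)) (at x)"
    and f_D2: "\<And>x. (Df has_derivative blinfun_apply (D2f x)) (at x)"
    and f_C2: "continuous_on UNIV D2f"
    and g_D: "\<And>x. (g has_derivative blinfun_apply (Dg x)) (at x)"
    and g_D2: "\<And>x. (Dg has_derivative blinfun_apply (D2g x)) (at x)"
    and g_C2: "continuous_on UNIV D2g"
    and K_closed: "closed K"
    and S_nonempty: "optimal_set f g K \<noteq> {}"
    and \<kappa>_pos: "\<kappa> > 0" and \<delta>_pos: "\<delta> > 0"
    and wsm: "local_2nd_order_weak_sharp_min f g K xb \<kappa> \<delta>"
    and rcq: "\<And>x d. x \<in> feasible_set g K \<inter> ball xb \<delta> \<Longrightarrow> d \<in> critical_cone Df Dg g K x \<Longrightarrow>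
                 DirRCQ Dg g K x d"
  shows "(\<forall>\<epsilon> x d. 0 \<le> \<epsilon> \<and> \<epsilon> < 1/2 \<and> x \<in> optimal_set f g K \<inter> ball xb \<delta>
            \<and> d \<in> critical_cone Df Dg g K x \<inter> eps_proximal_normal_cone \<epsilon> (optimal_set f g K) x \<longrightarrow>
            (\<forall>v \<in> asymptotic_second_tangent_cone K (g x) (Dg x d).
                \<exists>l \<in> dir_C_multipliers Df Dg g K x d. l \<bullet> v \<le> 0)
          \<and> (\<forall>w \<in> second_tangent_set K (g x) (Dg x d).
                \<exists>l \<in> dir_C_multipliers Df Dg g K x d.
                  hessL_dd D2f D2g x l d - l \<bullet> w \<ge> 2 * \<kappa> * (1 - 2 * \<epsilon>)^2 * (norm d)^2))
       \<and> (\<forall>x d. x \<in> optimal_set f g K \<inter> ball xb \<delta> \<and> d \<in> critical_cone Df Dg g K x \<longrightarrow>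
            (\<forall>v \<in> asymptotic_second_tangent_cone K (g x) (Dg x d).
                \<exists>l \<in> dir_C_multipliers Df Dg g K x d. l \<bullet> v \<le> 0)
          \<and> (\<forall>w \<in> second_tangent_set K (g x) (Dg x d).
                \<exists>l \<in> dir_C_multipliers Df Dg g K x d.
                  hessL_dd D2f D2g x l d - l \<bullet> w
                    \<ge> 2 * \<kappa> * (infdist d (tangent_cone (optimal_set f g K) x))^2))"
proof -
  let ?S = "optimal_set f g K"
  have asym: "\<exists>l \<in> dir_C_multipliers Df Dg g K x d. l \<bullet> v \<le> 0"
    if x: "x \<in> ?S \<inter> ball xb \<delta>" and d: "d \<in> critical_cone Df Dg g K x"
      and v: "v \<in> asymptotic_second_tangent_cone K (g x) (Dg x d)" for x d v
  proof -
    obtain t r wk where *: "\<And>k. t k > 0" "\<And>k. r k > 0" "t \<longlonglongrightarrow> 0" "r \<longlonglongrightarrow> 0"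
        "(\<lambda>k. t k / r k) \<longlonglongrightarrow> 0" "wk \<longlonglongrightarrow> v"
        "\<And>k. g x + t k *\<^sub>R Dg x d + ((1/2) * t k * r k) *\<^sub>R wk k \<in> K"
      using v unfolding asymptotic_second_tangent_cone_def by blast
    have cq: "DirRCQ Dg g K x d" using x d by (intro rcq) (auto simp: optimal_set_def)
    \<comment> \<open>With \<open>s k = (1/2) * t k * r k\<close> the weight of the quadratic term
      is \<open>t k / r k\<close>, so \<open>c = 0\<close>.\<close>
    have eq: "(1/2) * t k * r k / t k = r k / 2" "(t k)\<^sup>2 / (2 * ((1/2) * t k * r k)) = t k / r k" for k
      using *(1,2)[of k] by (auto simp: power2_eq_square)
    have lim: "(\<lambda>k. (1/2) * t k * r k / t k) \<longlonglongrightarrow> 0" "(\<lambda>k. (t k)\<^sup>2 / (2 * ((1/2) * t k * r k))) \<longlonglongrightarrow> 0"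
      unfolding eq using tendsto_divide[OF *(4) tendsto_const[of 2]] *(5) by simp_all
    have pos: "(1/2) * t k * r k > 0" for k using *(1,2)[of k] by simp
    have "\<exists>l\<in>dir_C_multipliers Df Dg g K x d.
      0 * hessL_dd D2f D2g x l d - l \<bullet> v \<ge> 0 * (2 * \<kappa> * (infdist d (tangent_cone ?S x))\<^sup>2)"
      by (rule second_order_multiplier[where f = f and Df = Df and D2f = D2f and g = g and
            Dg = Dg and D2g = D2g and x = x and d = d and t = t and
            s = "\<lambda>k. (1/2) * t k * r k" and w = wk,
            OF f_D f_D2 g_D g_D2 K_closed less_imp_le[OF \<kappa>_pos] wsm x d cq *(1) pos *(3) lim *(6,7)])
    then show ?thesis by simp
  qed
  have second: "\<exists>l \<in> dir_C_multipliers Df Dg g K x d.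
      hessL_dd D2f D2g x l d - l \<bullet> w \<ge> 2 * \<kappa> * (infdist d (tangent_cone ?S x))\<^sup>2"
    if x: "x \<in> ?S \<inter> ball xb \<delta>" and d: "d \<in> critical_cone Df Dg g K x"
      and w: "w \<in> second_tangent_set K (g x) (Dg x d)" for x d w
  proof -
    obtain t wk where *: "\<And>k. t k > 0" "t \<longlonglongrightarrow> 0" "wk \<longlonglongrightarrow> w"
        "\<And>k. g x + t k *\<^sub>R Dg x d + ((1/2) * (t k)\<^sup>2) *\<^sub>R wk k \<in> K"
      using w unfolding second_tangent_set_def by blast
    have cq: "DirRCQ Dg g K x d" using x d by (intro rcq) (auto simp: optimal_set_def)
    \<comment> \<open>With \<open>s k = (1/2) * (t k)\<^sup>2\<close> the weight is constantly 1, so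
      \<open>c = 1\<close>.\<close>
    have eq: "(1/2) * (t k)\<^sup>2 / t k = t k / 2" "(t k)\<^sup>2 / (2 * ((1/2) * (t k)\<^sup>2)) = 1" for k
      using *(1)[of k] by (auto simp: power2_eq_square)
    have lim: "(\<lambda>k. (1/2) * (t k)\<^sup>2 / t k) \<longlonglongrightarrow> 0" "(\<lambda>k. (t k)\<^sup>2 / (2 * ((1/2) * (t k)\<^sup>2))) \<longlonglongrightarrow> 1"
      unfolding eq using tendsto_divide[OF *(2) tendsto_const[of 2]] by simp_all
    have pos: "(1/2) * (t k)\<^sup>2 > 0" for k using *(1)[of k] by simp
    have "\<exists>l\<in>dir_C_multipliers Df Dg g K x d.
      1 * hessL_dd D2f D2g x l d - l \<bullet> w \<ge> 1 * (2 * \<kappa> * (infdist d (tangent_cone ?S x))\<^sup>2)"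
      by (rule second_order_multiplier[where f = f and Df = Df and D2f = D2f and g = g and
            Dg = Dg and D2g = D2g and x = x and d = d and t = t and
            s = "\<lambda>k. (1/2) * (t k)\<^sup>2" and w = wk,
            OF f_D f_D2 g_D g_D2 K_closed less_imp_le[OF \<kappa>_pos] wsm x d cq *(1) pos *(2) lim *(3,4)])
    then show ?thesis by simp
  qed
  \<comment> \<open>The bound by the tangent distance may be squared because \<epsilon> < 1/2 keeps
    its left side nonnegative.\<close>
  have eps: "2 * \<kappa> * (1 - 2 * \<epsilon>)\<^sup>2 * (norm d)\<^sup>2 \<le> 2 * \<kappa> * (infdist d (tangent_cone ?S x))\<^sup>2"
    if "\<epsilon> < 1/2" "x \<in> ?S" "d \<in> eps_proximal_normal_cone \<epsilon> ?S x" for \<epsilon> x d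
  proof -
    have "((1 - 2 * \<epsilon>) * norm d)\<^sup>2 \<le> (infdist d (tangent_cone ?S x))\<^sup>2"
      using eps_proximal_normal_infdist_tangent[OF that(2,3)] that(1) by (intro power_mono) auto
    then show ?thesis using \<kappa>_pos by (simp add: power_mult_distrib mult.assoc)
  qed
  show ?thesis
  proof (intro conjI allI impI ballI)
    fix \<epsilon> x d w
    assume "0 \<le> \<epsilon> \<and> \<epsilon> < 1/2 \<and> x \<in> ?S \<inter> ball xb \<delta>
      \<and> d \<in> critical_cone Df Dg g K x \<inter> eps_proximal_normal_cone \<epsilon> ?S x"
      and w: "w \<in> second_tangent_set K (g x) (Dg x d)"
    then have *: "\<epsilon> < 1/2" "x \<in> ?S \<inter> ball xb \<delta>" "d \<in> critical_cone Df Dg g K x"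
      "d \<in> eps_proximal_normal_cone \<epsilon> ?S x" by auto
    show "\<exists>l \<in> dir_C_multipliers Df Dg g K x d.
        hessL_dd D2f D2g x l d - l \<bullet> w \<ge> 2 * \<kappa> * (1 - 2 * \<epsilon>)^2 * (norm d)^2"
      using second[OF *(2,3) w] eps[OF *(1) _ *(4)] *(2) by (meson IntD1 order_trans)
  qed (use asym second in \<open>blast+\<close>)
qed

end
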